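(* Let $\Omega\subset\mathbb{R}^2$ be a bounded, simply connected, smooth domain with perimeter $L>0$. For all $t\in\mathcal{L}$, writing $S_t=\bigcup_{n=1}^N\Gamma_n$ with $N\in\mathbb{N}$ and $\Gamma_1,\dots,\Gamma_N$ pairwise disjoint piecewise-smooth simple closed curves, it holds that $$|S_t|+\sum_{n=1}^N\operatorname{dist}(\Gamma_n,S_t\setminus\Gamma_n)\le L-2\pi t.$$
   Context: For $t\ge0$, $S_t=\{x\in\overline{\Omega}:\operatorname{dist}(x,\partial\Omega)=t\}$ is the inner parallel curve, $|S_t|$ its length, and $r_{\rm i}(\Omega)=\max_{x\in\Omega}\operatorname{dist}(x,\partial\Omega)$ is the in-radius. Let $\gamma:\mathbb{R}/(L\mathbb{Z})\to\mathbb{R}^2$ be the counter-clockwise arc-length parametrization of $\partial\Omega$ and $\mathbf{n}(s)=(-\gamma_2'(s),\gamma_1'(s))^\top$ the inward unit normal. $\mathcal{L}\subset[0,r_{\rm i}(\Omega))$ denotes a fixed set, whose complement in $[0,r_{\rm i}(\Omega))$ has Lebesgue measure zero, such that for every $t\in\mathcal{L}$ there exist $m\in\mathbb{N}$ and $0\le a_1<b_1<a_2<b_2<\dots<a_m<b_m\le L$ for which $S_t$ is the union of the smooth curves $[a_k,b_k]\ni s\mapsto\gamma(s)+t\mathbf{n}(s)$, $k=1,\dots,m$, and this union forms a union of finitely many pairwise disjoint piecewise-smooth simple closed curves (the existence of such a set is a known result of Hartman). For sets $A,B$, $\operatorname{dist}(A,B)=\inf\{|a-b|:a\in A,\,b\in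 B\}$; in the case $N=1$ the term $\operatorname{dist}(\Gamma_1,\varnothing)$ is understood to be $0$. *)

theory Defs
  imports "HOL-Complex_Analysis.Complex_Analysis"
begin

(* The plane is the type complex. *)

(* C-infinity on S. On a closed interval S the derivatives at the endpoints are one-sided. *)
definition smooth_on :: "real set \<Rightarrow> (real \<Rightarrow> 'a::real_normed_vector) \<Rightarrow> bool" where
  "smooth_on S f \<longleftrightarrow>
     (\<exists>D :: nat \<Rightarrow> real \<Rightarrow> 'a. D 0 = f \<and>
        (\<forall>k. \<forall>s\<in>S. (D k has_vector_derivative D (Suc k) s) (at s within S)))"

(* Near each boundary point p, in coordinates centred at p and rotated by the unit e,
   the set is the strict epigraph of a smooth function. *)
definition smooth_boundary :: "complex set \<Rightarrow> bool" where
  "smooth_boundary \<Omega> \<longleftrightarrow>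
     (\<forall>p\<in>frontier \<Omega>. \<exists>r>0. \<exists>e. norm e = 1 \<and>
        (\<exists>g :: real \<Rightarrow> real. smooth_on UNIV g \<and>
           (\<forall>z\<in>ball 0 r. p + e * z \<in> \<Omega> \<longleftrightarrow> g (Re z) < Im z)))"

definition smooth_domain :: "complex set \<Rightarrow> bool" where
  "smooth_domain \<Omega> \<longleftrightarrow> \<Omega> \<noteq> {} \<and> open \<Omega> \<and> connected \<Omega> \<and> smooth_boundary \<Omega>"

(* A function on R/(LZ) is an L-periodic function on the reals. Since gamma has unit speed and
   traverses the boundary exactly once per period, L is the perimeter. *)
definition ccw_arclength_param :: "complex set \<Rightarrow> real \<Rightarrow> (real \<Rightarrow> complex) \<Rightarrow> bool" where
  "ccw_arclength_param \<Omega> L \<gamma> \<longleftrightarrow>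
     smooth_on UNIV \<gamma> \<and>
     (\<forall>s. \<gamma> (s + L) = \<gamma> s) \<and>
     inj_on \<gamma> {0..<L} \<and>
     \<gamma> ` {0..<L} = frontier \<Omega> \<and>
     (\<forall>s. norm (vector_derivative \<gamma> (at s)) = 1) \<and>
     (\<forall>z\<in>\<Omega>. winding_number (\<lambda>u. \<gamma> (L * u)) z = 1)"

(* Multiplication by i sends (x, y) to (-y, x). *)
definition inward_normal :: "(real \<Rightarrow> complex) \<Rightarrow> real \<Rightarrow> complex" where
  "inward_normal \<gamma> s = \<i> * vector_derivative \<gamma> (at s)"

definition inner_parallel_curve :: "complex set \<Rightarrow> real \<Rightarrow> complex set" where
  "inner_parallel_curve \<Omega> t = {x \<in> closure \<Omega>. infdist x (frontier \<Omega>) = t}"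

definition inradius :: "complex set \<Rightarrow> real" where
  "inradius \<Omega> = (SUP x\<in>\<Omega>. infdist x (frontier \<Omega>))"

(* Length of a plane set: the one-dimensional Hausdorff (outer) measure, which on rectifiable
   simple curves is the usual arc length. The bounded requirement is needed because diameter
   is unspecified on unbounded sets. *)
definition set_length :: "complex set \<Rightarrow> ennreal" where
  "set_length A =
     (SUP \<delta>\<in>{0<..}. INF U\<in>{U :: nat \<Rightarrow> complex set.
          A \<subseteq> (\<Union>i. U i) \<and> (\<forall>i. bounded (U i) \<and> diameter (U i) \<le> \<delta>)}.
        (\<Sum>i. ennreal (diameter (U i))))"

definition piecewise_smooth :: "(real \<Rightarrow> complex) \<Rightarrow> bool" where
  "piecewise_smooth p \<longleftrightarrow>
     (\<exists>(m::nat) (\<tau> :: nat \<Rightarrow> real). \<tau> 0 = 0 \<and> \<tau> m = 1 \<and>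
        (\<forall>i<m. \<tau> i < \<tau> (Suc i) \<and> smooth_on {\<tau> i..\<tau> (Suc i)} p))"

definition simple_closed_pw_smooth_curve :: "complex set \<Rightarrow> bool" where
  "simple_closed_pw_smooth_curve \<Gamma> \<longleftrightarrow>
     (\<exists>p. simple_path p \<and> pathfinish p = pathstart p \<and> piecewise_smooth p \<and> path_image p = \<Gamma>)"

definition closed_curve_decomposition ::
    "complex set \<Rightarrow> nat \<Rightarrow> (nat \<Rightarrow> complex set) \<Rightarrow> bool" where
  "closed_curve_decomposition S N \<Gamma> \<longleftrightarrow>
     N \<ge> 1 \<and> S = (\<Union>n\<in>{1..N}. \<Gamma> n) \<and>
     (\<forall>n\<in>{1..N}. simple_closed_pw_smooth_curve (\<Gamma> n)) \<and>
     disjoint_family_on \<Gamma> {1..N}"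

definition regular_distance :: "complex set \<Rightarrow> real \<Rightarrow> (real \<Rightarrow> complex) \<Rightarrow> real \<Rightarrow> bool" where
  "regular_distance \<Omega> L \<gamma> t \<longleftrightarrow>
     (\<exists>(m::nat) (a :: nat \<Rightarrow> real) (b :: nat \<Rightarrow> real).
        m \<ge> 1 \<and> 0 \<le> a 1 \<and> b m \<le> L \<and>
        (\<forall>k\<in>{1..m}. a k < b k) \<and> (\<forall>k\<in>{1..<m}. b k < a (Suc k)) \<and>
        inner_parallel_curve \<Omega> t =
          (\<Union>k\<in>{1..m}. (\<lambda>s. \<gamma> s + t *\<^sub>R inward_normal \<gamma> s) ` {a k..b k})) \<and>
     (\<exists>N \<Gamma>. closed_curve_decomposition (inner_parallel_curve \<Omega> t) N \<Gamma>)"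

definition hartman_set :: "complex set \<Rightarrow> real \<Rightarrow> (real \<Rightarrow> complex) \<Rightarrow> real set \<Rightarrow> bool" where
  "hartman_set \<Omega> L \<gamma> T \<longleftrightarrow>
     T \<subseteq> {0..<inradius \<Omega>} \<and>
     {0..<inradius \<Omega>} - T \<in> null_sets lebesgue \<and>
     (\<forall>t\<in>T. regular_distance \<Omega> L \<gamma> t)"

end

theory Submission
  imports Defs
begin

text \<open>
  Write \<open>\<sigma> s = \<gamma> s + t n(s)\<close> for the point at distance \<open>t\<close> along the inward normal and \<open>\<theta>\<close> for a
  continuous tangent angle, \<open>\<gamma>' = cis \<theta>\<close>. Everything follows from one estimate
  (\<open>chord_turning_bound\<close>): if \<open>s \<le> s' < s + L\<close> and both \<open>\<sigma> s\<close> and \<open>\<sigma> s'\<close> lie on \<open>S\<^sub>t\<close>, then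
  \<open>\<bar>\<sigma> s' - \<sigma> s\<bar> \<le> g s' - g s\<close> with \<open>g s = s - t \<theta>(s)\<close>. On the parameter arcs that make up \<open>S\<^sub>t\<close> it
  says that \<open>\<sigma>\<close> is dominated by the nondecreasing function \<open>g\<close>, so the length of an arc is at most the
  increase of \<open>g\<close>. Across the gap between two consecutive arcs it bounds the jump of \<open>\<sigma>\<close> by the
  increase of \<open>g\<close>. Since \<open>\<theta>\<close> grows by \<open>2\<pi>\<close> per period, the increases of \<open>g\<close> over one period
  telescope to \<open>L - 2\<pi>t\<close>. Finally, when there are several curves \<open>\<Gamma>\<^sub>n\<close>, the cyclic sequence of
  arcs must leave each \<open>\<Gamma>\<^sub>n\<close> at some gap, and the jump there is at least the distance from
  \<open>\<Gamma>\<^sub>n\<close> to the rest; different \<open>n\<close> use different gaps.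

  For the estimate, let \<open>p = \<sigma> b\<close> and \<open>q = \<sigma> a\<close>. The curve \<open>\<gamma>\<close> stays outside the open discs of radius
  \<open>t\<close> around \<open>p\<close> and \<open>q\<close>, starts tangentially on the first and ends tangentially on the second. A
  string pulled tight around the two discs runs along the first circle, along a straight segment of
  length \<open>\<bar>q - p\<bar>\<close>, and along the second circle; its length, with the two circular pieces counted with
  sign, is \<open>\<bar>q - p\<bar> + t (\<theta>(a) - \<theta>(b))\<close>. The lower bound on the length of \<open>\<gamma>\<close> is obtained by
  splitting \<open>\<gamma>\<close> at one point and measuring the first part by the angle seen from \<open>p\<close> and the second part
  by the angle seen from \<open>q\<close> (\<open>turning_estimate\<close>). What has to be excluded is that the
  angle seen from \<open>q\<close>, normalised at \<open>a\<close>, is ahead of the angle seen from \<open>p\<close>, normalised at \<open>b\<close>, by a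
  full turn or more at the splitting point. Here the simplicity of \<open>\<gamma>\<close> enters, through Hopf's device of a continuous angle \<open>B x y\<close> of the chord from
  \<open>\<gamma> x\<close> to \<open>\<gamma> y\<close>: at a point of \<open>\<gamma>\<close> that is extremal in the direction orthogonal to \<open>q - p\<close>, all
  earlier points and all later points lie on the same side, which pins both angles down
  (\<open>chord_sheets_at_extremum\<close>).
\<close>

section \<open>Arguments of plane vectors\<close>

text \<open>Arguments are real numbers, not classes modulo \<open>2\<pi>\<close>: the proof compares continuous choices of
arguments along curves and has to see the multiples of \<open>2\<pi>\<close>. The zero vector has every argument.\<close>

definition has_arg :: "complex \<Rightarrow> real \<Rightarrow> bool" where
  "has_arg z A \<longleftrightarrow> z = of_real (cmod z) * cis A"

lemma inner_cis_cis: "cis x \<bullet> cis y = cos (x - y)"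
  by (simp add: inner_complex_def cos_diff)

lemma inner_i_cis: "cis x \<bullet> (\<i> * cis y) = sin (x - y)"
  by (simp add: inner_complex_def sin_diff)

lemma inner_of_real_mult: "(of_real r * z) \<bullet> w = r * (z \<bullet> (w::complex))"
  by (simp add: inner_complex_def algebra_simps)

lemma has_arg_inner:
  assumes "has_arg z A"
  shows "z \<bullet> cis c = cmod z * cos (A - c)" and "z \<bullet> (\<i> * cis c) = cmod z * sin (A - c)"
  using assms unfolding has_arg_def
  by (metis inner_of_real_mult inner_cis_cis, metis inner_of_real_mult inner_i_cis)

lemma has_arg_inner2:
  assumes "has_arg z A" "has_arg w C"
  shows "z \<bullet> w = cmod z * cmod w * cos (A - C)"
proof -
  have "z \<bullet> w = w \<bullet> z" by (rule inner_commute)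
  also have "\<dots> = cmod w * (cis C \<bullet> z)"
    using assms(2) inner_of_real_mult unfolding has_arg_def by metis
  also have "\<dots> = cmod w * (cmod z * cos (A - C))"
    using has_arg_inner(1)[OF assms(1)] by (simp add: inner_commute)
  finally show ?thesis by simp
qed

lemma pos_of_norm_mult_pos:
  fixes x :: real and v :: "'a::real_normed_vector"
  assumes "0 < norm v * x" shows "0 < x"
  using assms mult_nonneg_nonpos[OF norm_ge_zero, of x v] by (meson not_le)

lemma has_arg_uminus: "has_arg z A \<Longrightarrow> has_arg (- z) (A - pi)"
  unfolding has_arg_def by (simp add: complex_eq_iff cos_diff sin_diff)

lemma has_arg_cnj:
  assumes "has_arg z A" shows "has_arg (cnj z) (- A)"
proof -
  have "cnj z = cnj (of_real (cmod z) * cis A)" using assms unfolding has_arg_def by simp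
  then show ?thesis unfolding has_arg_def complex_mod_cnj by (simp only: complex_cnj_mult complex_cnj_complex_of_real cis_cnj)
qed

lemma inner_cnj_cis:
  "cnj z \<bullet> cis (- c) = z \<bullet> cis c" "cnj z \<bullet> (\<i> * cis (- c)) = - (z \<bullet> (\<i> * cis c))"
  by (simp_all add: inner_complex_def)

lemma has_arg_exists: "\<exists>A. has_arg z A"
  unfolding has_arg_def by (metis rcis_cmod_Arg rcis_def)

lemma has_arg_add_int: "has_arg z A \<Longrightarrow> has_arg z (A + 2 * pi * of_int k)"
  unfolding has_arg_def by (simp add: cis_mult[symmetric] cis_multiple_2pi)

lemma has_arg_unique:
  assumes "has_arg z A" "has_arg z C" "z \<noteq> 0"
  obtains k :: int where "C = A + 2 * pi * of_int k"
proof -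
  have "cis A = cis C" using assms unfolding has_arg_def
    by (metis mult_cancel_left norm_eq_zero of_real_eq_0_iff)
  then have "sin A = sin C \<and> cos A = cos C"
    by (metis cis.simps)
  then obtain k :: int where "A = C + 2 * pi * of_int k" using sin_cos_eq_iff by (metis mult.commute mult.assoc)
  then have "C = A + 2 * pi * of_int (-k)" by simp
  then show thesis using that by blast
qed

text \<open>The set where the cosine is nonnegative splits into the intervals of radius \<open>\<pi>/2\<close> around the
multiples of \<open>2\<pi>\<close>, so a continuous function with values in it stays in one interval. This is how a
congruence modulo \<open>2\<pi>\<close> known at one point is propagated along a curve.\<close>

lemma abs_le_half_pi_on_connected:
  fixes f :: "'a::topological_space \<Rightarrow> real"
  assumes "connected S" "continuous_on S f" "\<And>s. s \<in> S \<Longrightarrow> cos (f s) \<ge> 0"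
    and "x \<in> S" "\<bar>f x\<bar> \<le> pi/2" "s \<in> S"
  shows "\<bar>f s\<bar> \<le> pi/2"
proof (rule ccontr)
  assume H: "\<not> ?thesis"
  have iv: "is_interval (f ` S)"
    using assms(1,2) connected_continuous_image is_interval_connected_1 by blast
  have bad: False if "v \<in> f ` S" "pi/2 < \<bar>v\<bar>" "\<bar>v\<bar> < 3*pi/2" for v
  proof -
    have "cos \<bar>v\<bar> < 0"
    proof -
      have "cos (\<bar>v\<bar> - pi) > 0" using that by (intro cos_gt_zero_pi) auto
      then show ?thesis by (simp add: cos_diff)
    qed
    then have "cos v < 0" by (simp add: cos_abs_real)
    then show False using that(1) assms(3) by force
  qed
  \<comment> \<open>A value of \<open>f\<close> strictly between the allowed intervals: \<open>f s\<close> itself, cut off at \<open>\<plusminus>\<pi>\<close>.\<close>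
  define v where "v = min \<bar>f s\<bar> pi * sgn (f s)"
  have "v \<in> f ` S"
  proof (cases "f s > 0")
    case True
    then have "f x \<le> v" "v \<le> f s" using assms(5) H pi_gt_zero unfolding v_def by auto
    then show ?thesis using mem_is_interval_1_I[OF iv] assms(4,6) by blast
  next
    case False
    then have n: "f s < 0" using H pi_gt_zero by (cases "f s = 0") auto
    then have "f s \<le> v" "v \<le> f x" using assms(5) H pi_gt_zero unfolding v_def by auto
    then show ?thesis using mem_is_interval_1_I[OF iv] assms(4,6) by blast
  qed
  moreover have "\<bar>v\<bar> = min \<bar>f s\<bar> pi" using H pi_gt_zero unfolding v_def by (auto simp: abs_mult sgn_if)
  moreover have "min \<bar>f s\<bar> pi < 3*pi/2" "pi/2 < min \<bar>f s\<bar> pi" using H pi_gt_zero by (auto simp: min_def)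
  ultimately show False using bad[of v] by simp
qed

text \<open>With \<open>v\<close> outside the open disc of radius \<open>t\<close> around \<open>0\<close> and \<open>w\<close> on its circle, the side from \<open>0\<close> to \<open>v\<close>
of the triangle \<open>0, w, v\<close> is at least as long as the one from \<open>0\<close> to \<open>w\<close>. So the angle at \<open>v\<close> is
not the larger of two angles, hence acute.\<close>

lemma tangent_disc_inner_pos:
  fixes v w :: complex
  assumes "cmod v \<ge> t" "cmod w = t" "v \<noteq> w"
  shows "v \<bullet> (v - w) > 0"
proof -
  have a: "v \<bullet> w \<le> cmod v * cmod w" by (rule norm_cauchy_schwarz)
  have e: "v \<bullet> (v - w) = (cmod v)^2 - v \<bullet> w"
    by (simp add: inner_diff_right power2_norm_eq_inner)
  have "cmod v * cmod w \<le> (cmod v)^2"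
    using assms(1,2) by (simp add: power2_eq_square mult_left_mono)
  moreover have False if "v \<bullet> w = (cmod v)\<^sup>2"
  proof -
    have "(cmod (v - w))\<^sup>2 = (cmod v)\<^sup>2 - 2 * (v \<bullet> w) + (cmod w)\<^sup>2"
      by (simp add: power2_norm_eq_inner inner_diff_left inner_diff_right inner_commute)
    also have "\<dots> = (cmod w)\<^sup>2 - (cmod v)\<^sup>2" using that by simp
    also have "\<dots> \<le> 0" using assms(1,2) norm_ge_zero[of w] by (simp add: power_mono del: norm_ge_zero)
    finally show False using assms(3) by auto
  qed
  ultimately show ?thesis using a e by (smt (verit))
qed

lemma abs_less_half_pi_if_cos_pos:
  assumes "cos x > 0" "\<bar>x\<bar> < 3*pi/2"
  shows "\<bar>x\<bar> < pi/2"
proof (rule ccontr)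
  assume "\<not> ?thesis"
  then have "cos (\<bar>x\<bar> - pi) \<ge> 0" using assms(2) by (intro cos_ge_zero) auto
  then have "cos \<bar>x\<bar> \<le> 0" by (simp add: cos_diff)
  then show False using assms(1) by (simp add: cos_abs_real)
qed

lemma mult_cos_le_sin: 
  assumes "0 \<le> x" "x < pi/2" shows "x * cos x \<le> sin x"
proof -
  let ?f = "\<lambda>x. sin x - x * cos x"
  have "?f 0 \<le> ?f x"
  proof (rule DERIV_nonneg_imp_nondecreasing[OF assms(1)])
    fix y assume y: "0 \<le> y" "y \<le> x"
    have "(?f has_real_derivative (cos y - (cos y - y * sin y))) (at y)"
      by (auto intro!: derivative_eq_intros)
    moreover have "cos y - (cos y - y * sin y) \<ge> 0" using y assms sin_ge_zero[of y] by simp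
    ultimately show "\<exists>z. (?f has_real_derivative z) (at y) \<and> 0 \<le> z" by blast
  qed
  then show ?thesis by simp
qed

section \<open>Length of a curve outside a disc\<close>

text \<open>Along a unit-speed curve outside the disc of radius \<open>t\<close> around \<open>0\<close>, the argument changes at rate at
most \<open>1/t\<close>. The curve is followed until its argument is \<open>c\<close>, which costs \<open>t (c - A x)\<close>, and then
measured by its progress in the direction \<open>\<i> * cis c\<close> orthogonal to the ray of argument \<open>c\<close>. The
bound is needed also when \<open>A\<close> starts beyond \<open>c\<close> or does not reach it; a missing or superfluous
angle \<open>\<eta>\<close> is then paid for by \<open>sin \<eta> \<le> \<eta> \<le> tan \<eta>\<close>.\<close>

lemma turning_estimate:
  fixes f :: "real \<Rightarrow> complex" and A :: "real \<Rightarrow> real"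
  assumes xy: "x \<le> y" and t: "t > 0"
    and lip: "\<And>r s. r \<in> {x..y} \<Longrightarrow> s \<in> {x..y} \<Longrightarrow> cmod (f r - f s) \<le> \<bar>r - s\<bar>"
    and arg: "\<And>s. s \<in> {x..y} \<Longrightarrow> has_arg (f s) (A s)"
    and Alip: "\<And>r s. r \<in> {x..y} \<Longrightarrow> s \<in> {x..y} \<Longrightarrow> t * \<bar>A r - A s\<bar> \<le> \<bar>r - s\<bar>"
    and cont: "continuous_on {x..y} A"
    and start: "cmod (f x) = t"
    and c: "c \<le> A x \<or> c \<le> A y \<or> (\<bar>A y - c\<bar> < pi/2 \<and> f y \<bullet> cis c \<ge> t)"
  shows "t * (c - A x) + f y \<bullet> (\<i> * cis c) \<le> y - x"
proof -
  let ?u = "\<i> * cis c"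
  have nu: "cmod ?u = 1" by (simp add: norm_mult)
  have step: "f r \<bullet> ?u - f s \<bullet> ?u \<le> r - s" if "x \<le> s" "s \<le> r" "r \<le> y" for r s
  proof -
    have "f r \<bullet> ?u - f s \<bullet> ?u = (f r - f s) \<bullet> ?u" by (simp add: inner_diff_left)
    also have "\<dots> \<le> cmod (f r - f s) * cmod ?u" by (rule norm_cauchy_schwarz)
    also have "\<dots> \<le> r - s" using lip[of r s] that nu by simp
    finally show ?thesis .
  qed
  consider "c \<le> A x" | "A x < c" "c \<le> A y" | "A y < c" "\<bar>A y - c\<bar> < pi/2" "f y \<bullet> cis c \<ge> t"
    using c by linarith
  then show ?thesis
  proof cases
    case 1
    have "f x \<bullet> ?u = t * sin (A x - c)"
      using has_arg_inner(2)[OF arg[of x], of c] start xy by simp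
    also have "\<dots> \<le> t * (A x - c)" using t sin_x_le_x 1 by (intro mult_left_mono) auto
    finally show ?thesis using step[of x y] xy by (simp add: algebra_simps)
  next
    case 2
    obtain s where s: "x \<le> s" "s \<le> y" "A s = c"
      using IVT'[of A x c y] 2 xy cont by auto
    have "f s \<bullet> ?u = 0" using has_arg_inner(2)[OF arg[of s], of c] s by simp
    moreover have "t * (c - A x) \<le> s - x"
      using Alip[of s x] s 2 xy by (auto simp: abs_if)
    ultimately show ?thesis using step[of s y] s by simp
  next
    case 3
    define \<eta> where "\<eta> = c - A y"
    have e: "0 < \<eta>" "\<eta> < pi/2" using 3 unfolding \<eta>_def by auto
    have ya: "has_arg (f y) (A y)" using arg xy by simp
    have d: "t \<le> cmod (f y) * cos \<eta>"
      using has_arg_inner(1)[OF ya, of c] 3(3) unfolding \<eta>_def by (simp add: cos_diff mult.commute)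
    have "t * \<eta> \<le> cmod (f y) * cos \<eta> * \<eta>" using d e by (intro mult_right_mono) auto
    also have "\<dots> = cmod (f y) * (\<eta> * cos \<eta>)" by simp
    also have "\<dots> \<le> cmod (f y) * sin \<eta>" using mult_cos_le_sin[of \<eta>] e by (intro mult_left_mono) auto
    finally have h: "t * \<eta> \<le> cmod (f y) * sin \<eta>" .
    have "f y \<bullet> ?u = cmod (f y) * sin (- \<eta>)"
      using has_arg_inner(2)[OF ya, of c] unfolding \<eta>_def by simp
    then have "f y \<bullet> ?u \<le> - (t * \<eta>)" using h by simp
    moreover have "t * (A y - A x) \<le> y - x"
      using Alip[of y x] xy t by (smt (verit) atLeastAtMost_iff mult_left_mono)
    ultimately show ?thesis unfolding \<eta>_def by (simp add: algebra_simps)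
  qed
qed

lemma has_arg_I: "r \<ge> 0 \<Longrightarrow> z = of_real r * cis A \<Longrightarrow> has_arg z A"
  unfolding has_arg_def by (simp add: norm_mult)

text \<open>The argument is the imaginary part of a primitive of \<open>f' / f\<close>. Defining it by an integral gives the
Lipschitz constant \<open>1/t\<close> for unit-speed curves at distance at least \<open>t\<close> from the origin at once.\<close>

lemma arg_lift:
  fixes f f' :: "real \<Rightarrow> complex"
  assumes x0: "x0 \<in> {x..y}" 
    and deriv: "\<And>s. s \<in> {x..y} \<Longrightarrow> (f has_vector_derivative f' s) (at s within {x..y})"
    and cont: "continuous_on {x..y} f'"
    and nz: "\<And>s. s \<in> {x..y} \<Longrightarrow> f s \<noteq> 0"
    and start: "has_arg (f x0) \<alpha>"
  obtains A where "continuous_on {x..y} A" "A x0 = \<alpha>" "\<And>s. s \<in> {x..y} \<Longrightarrow> has_arg (f s) (A s)"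
    "\<And>t r s. t > 0 \<Longrightarrow> (\<And>s. s \<in> {x..y} \<Longrightarrow> cmod (f' s) \<le> 1 \<and> t \<le> cmod (f s)) \<Longrightarrow>
        r \<in> {x..y} \<Longrightarrow> s \<in> {x..y} \<Longrightarrow> t * \<bar>A r - A s\<bar> \<le> \<bar>r - s\<bar>"
proof -
  have cf: "continuous_on {x..y} f"
    using deriv by (meson continuous_on_eq_continuous_within has_vector_derivative_continuous)
  have "continuous_on {x..y} (\<lambda>s. f' s / f s)"
    using cont cf nz by (intro continuous_intros) auto
  then obtain G where G: "\<And>s. s \<in> {x..y} \<Longrightarrow> (G has_vector_derivative (f' s / f s)) (at s within {x..y})"
    using antiderivative_continuous by blast
  have cG: "continuous_on {x..y} G"
    using G by (meson continuous_on_eq_continuous_within has_vector_derivative_continuous)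
  define A where "A s = \<alpha> + Im (G s - G x0)" for s
  have dE: "((\<lambda>s. exp (- G s)) has_vector_derivative (- (f' s / f s) * exp (- G s))) (at s within {x..y})"
    if s: "s \<in> {x..y}" for s
  proof -
    have "((\<lambda>s. - G s) has_vector_derivative - (f' s / f s)) (at s within {x..y})"
      using has_vector_derivative_minus[OF G[OF s]] .
    from field_vector_diff_chain_within[OF this, of exp "exp (- G s)"] show ?thesis
      by (simp add: o_def DERIV_exp DERIV_subset[OF DERIV_exp])
  qed
  \<comment> \<open>The quotient of \<open>f\<close> and \<open>exp G\<close> has derivative zero.\<close>
  have h: "f s * exp (- G s) = f x0 * exp (- G x0)" if s: "s \<in> {x..y}" for s
  proof (rule has_derivative_zero_unique[of "{x..y}" "\<lambda>s. f s * exp (- G s)"])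
    show "convex {x..y}" by simp
    fix u assume u: "u \<in> {x..y}"
    have "((\<lambda>s. f s * exp (- G s)) has_vector_derivative (f u * (- (f' u / f u) * exp (- G u)) + f' u * exp (- G u))) (at u within {x..y})"
      by (rule has_vector_derivative_mult[OF deriv[OF u] dE[OF u]])
    moreover have "f u * (- (f' u / f u) * exp (- G u)) + f' u * exp (- G u) = 0"
      using nz[OF u] by simp
    ultimately show "((\<lambda>s. f s * exp (- G s)) has_derivative (\<lambda>h. 0)) (at u within {x..y})"
      by (simp add: has_vector_derivative_def)
  qed (use s x0 in auto)
  have "has_arg (f s) (A s)" if s: "s \<in> {x..y}" for s
  proof (rule has_arg_I)
    have "f s = f x0 * exp (G s - G x0)"
      using h[OF s] by (simp add: exp_diff exp_minus field_simps)
    also have "\<dots> = of_real (cmod (f x0)) * cis \<alpha> * (of_real (exp (Re (G s - G x0))) * cis (Im (G s - G x0)))"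
      using start unfolding has_arg_def by (metis exp_eq_polar)
    finally show "f s = of_real (cmod (f x0) * exp (Re (G s - G x0))) * cis (A s)"
      unfolding A_def by (simp add: cis_mult[symmetric])
  qed simp
  moreover have "continuous_on {x..y} A" unfolding A_def using cG by (intro continuous_intros)
  moreover have "t * \<bar>A r - A s\<bar> \<le> \<bar>r - s\<bar>"
    if t: "t > 0" and b: "\<And>s. s \<in> {x..y} \<Longrightarrow> cmod (f' s) \<le> 1 \<and> t \<le> cmod (f s)"
      and rs: "r \<in> {x..y}" "s \<in> {x..y}" for t r s
  proof -
    have "cmod (G r - G s) \<le> (1/t) * norm (r - s)"
    proof (rule differentiable_bound[of "{x..y}"])
      fix u assume u: "u \<in> {x..y}"
      show "(G has_derivative (\<lambda>h. h *\<^sub>R (f' u / f u))) (at u within {x..y})"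
        using G[OF u] by (simp add: has_vector_derivative_def)
      have "cmod (f' u / f u) \<le> 1 / t"
        using b[OF u] t by (simp add: norm_divide frac_le)
      then have "norm (h *\<^sub>R (f' u / f u)) \<le> (1/t) * norm h" for h
        using mult_left_mono[of "cmod (f' u / f u)" "1/t" "\<bar>h\<bar>"] by (simp add: mult.commute del: norm_divide)
      then show "onorm (\<lambda>h. h *\<^sub>R (f' u / f u)) \<le> 1 / t"
        using t by (intro onorm_le) auto
    qed (use rs in auto)
    moreover have "\<bar>A r - A s\<bar> \<le> cmod (G r - G s)"
      unfolding A_def using abs_Im_le_cmod[of "G r - G s"] by simp
    ultimately have "\<bar>A r - A s\<bar> \<le> \<bar>r - s\<bar> / t" by simp
    then show ?thesis using t by (simp add: field_simps)
  qed
  moreover have "A x0 = \<alpha>" unfolding A_def by simp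
  ultimately show thesis using that by blast
qed

section \<open>The angle of a chord and the angle seen from a tangent disc\<close>

text \<open>Here \<open>B s\<close> is a continuous angle of the chord from \<open>\<gamma> b\<close> to \<open>\<gamma> s\<close>, so \<open>B b\<close> is the tangent angle at
\<open>b\<close>, and \<open>p\<close> is the centre of a circle touching the curve at \<open>\<gamma> b\<close> from the left. As the curve avoids
the disc, the directions to \<open>\<gamma> s\<close> from \<open>p\<close> and from \<open>\<gamma> b\<close> make an acute angle. The difference of
the two continuous angles is \<open>-\<pi>/2\<close> at the start, so it stays in the principal interval.\<close>

lemma arg_near_chord_from_start:
  fixes \<gamma> :: "real \<Rightarrow> complex" and B :: "real \<Rightarrow> real"
  assumes ba: "b \<le> a"
    and B: "continuous_on {b..a} B" "\<And>s. s \<in> {b<..a} \<Longrightarrow> has_arg (\<gamma> s - \<gamma> b) (B s)"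
    and inj: "\<And>s. s \<in> {b<..a} \<Longrightarrow> \<gamma> s \<noteq> \<gamma> b"
    and A: "continuous_on {b..a} A" "\<And>s. s \<in> {b..a} \<Longrightarrow> has_arg (\<gamma> s - p) (A s)"
    and start: "A b = B b - pi/2"
    and t: "t > 0" "cmod (\<gamma> b - p) = t" "\<And>s. s \<in> {b..a} \<Longrightarrow> t \<le> cmod (\<gamma> s - p)"
    and s: "s \<in> {b..a}"
  shows "\<bar>A s - B s\<bar> \<le> pi/2" "s > b \<Longrightarrow> \<bar>A s - B s\<bar> < pi/2"
proof -
  have pos: "cos (A s - B s) > 0" if s: "s \<in> {b<..a}" for s
  proof -
    have "(\<gamma> s - p) \<bullet> ((\<gamma> s - p) - (\<gamma> b - p)) > 0"
      using s inj t by (intro tangent_disc_inner_pos[of t]) auto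
    moreover have "(\<gamma> s - p) \<bullet> (\<gamma> s - \<gamma> b) = cmod (\<gamma> s - p) * cmod (\<gamma> s - \<gamma> b) * cos (A s - B s)"
      using A(2) B(2) s by (intro has_arg_inner2) auto
    ultimately show ?thesis by (auto simp: mult.assoc dest!: pos_of_norm_mult_pos)
  qed
  have "cos (A s - B s) \<ge> 0" if "s \<in> {b..a}" for s
    using pos[of s] that start by (cases "s = b") auto
  moreover have "continuous_on {b..a} (\<lambda>s. A s - B s)" by (intro continuous_on_diff A B)
  ultimately show le: "\<bar>A s - B s\<bar> \<le> pi/2"
    by - (rule abs_le_half_pi_on_connected[where f = "\<lambda>s. A s - B s" and S = "{b..a}" and x = b],
      use ba s start in simp_all)
  assume "s > b"
  then have "cos (A s - B s) > 0" using pos s by simp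
  then show "\<bar>A s - B s\<bar> < pi/2" by (rule abs_less_half_pi_if_cos_pos) (use le pi_gt_zero in linarith)
qed

text \<open>The counterpart at the other end of the curve. The chord from \<open>\<gamma> s\<close> to the end point \<open>\<gamma> a\<close> points
towards the circle, whence the shift by \<open>\<pi>\<close>.\<close>

lemma arg_near_chord_to_end:
  fixes \<gamma> :: "real \<Rightarrow> complex" and B :: "real \<Rightarrow> real"
  assumes ba: "b \<le> a"
    and B: "continuous_on {b..a} B" "\<And>s. s \<in> {b..<a} \<Longrightarrow> has_arg (\<gamma> a - \<gamma> s) (B s)"
    and inj: "\<And>s. s \<in> {b..<a} \<Longrightarrow> \<gamma> s \<noteq> \<gamma> a"
    and A: "continuous_on {b..a} A" "\<And>s. s \<in> {b..a} \<Longrightarrow> has_arg (\<gamma> s - q) (A s)"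
    and start: "A a = B a - pi/2"
    and t: "t > 0" "cmod (\<gamma> a - q) = t" "\<And>s. s \<in> {b..a} \<Longrightarrow> t \<le> cmod (\<gamma> s - q)"
    and s: "s \<in> {b..a}"
  shows "\<bar>A s - (B s - pi)\<bar> \<le> pi/2" "s < a \<Longrightarrow> \<bar>A s - (B s - pi)\<bar> < pi/2"
proof -
  have pos: "cos (A s - (B s - pi)) > 0" if s: "s \<in> {b..<a}" for s
  proof -
    have "(\<gamma> s - q) \<bullet> ((\<gamma> s - q) - (\<gamma> a - q)) > 0"
      using s inj t by (intro tangent_disc_inner_pos[of t]) auto
    moreover have "(\<gamma> s - q) \<bullet> (\<gamma> s - \<gamma> a) = cmod (\<gamma> s - q) * cmod (\<gamma> s - \<gamma> a) * cos (A s - (B s - pi))"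
      using A(2) has_arg_uminus[OF B(2)[OF s]] s by (intro has_arg_inner2) auto
    ultimately show ?thesis by (auto simp: mult.assoc dest!: pos_of_norm_mult_pos)
  qed
  have "cos (A s - (B s - pi)) \<ge> 0" if "s \<in> {b..a}" for s
    using pos[of s] that start by (cases "s = a") auto
  moreover have "continuous_on {b..a} (\<lambda>s. A s - (B s - pi))" by (intro continuous_on_diff continuous_on_const A B)
  ultimately show le: "\<bar>A s - (B s - pi)\<bar> \<le> pi/2"
    by - (rule abs_le_half_pi_on_connected[where f = "\<lambda>s. A s - (B s - pi)" and S = "{b..a}" and x = a],
      use ba s start in simp_all)
  assume "s < a"
  then have "cos (A s - (B s - pi)) > 0" using pos s by simp
  then show "\<bar>A s - (B s - pi)\<bar> < pi/2" by (rule abs_less_half_pi_if_cos_pos) (use le pi_gt_zero in linarith)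
qed

text \<open>If \<open>\<gamma> s\<close> is extremal in the direction \<open>cis \<psi>\<close>, then the chords arriving at \<open>\<gamma> s\<close> point into one
closed half-plane and the chords leaving it point into the opposite one. Both families of angles are
therefore confined to intervals of length \<open>\<pi>\<close>, and both converge to the same tangent angle at \<open>s\<close>.
If the curve turns left at \<open>s\<close>, this forces \<open>i = j\<close>; if it turns right, then \<open>j = i - 1\<close>.\<close>

lemma chord_sheets_at_extremum:
  fixes \<gamma> :: "real \<Rightarrow> complex" and B :: "real \<Rightarrow> real \<Rightarrow> real"
  assumes s: "b < s" "s < a"
    and cB1: "continuous_on {b..s} (\<lambda>x. B x s)" and cB2: "continuous_on {s..a} (B s)"
    and B: "\<And>x y. b \<le> x \<Longrightarrow> x < y \<Longrightarrow> y \<le> a \<Longrightarrow> has_arg (\<gamma> y - \<gamma> x) (B x y)"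
    and inj: "\<And>x y. b \<le> x \<Longrightarrow> x < y \<Longrightarrow> y \<le> a \<Longrightarrow> \<gamma> y \<noteq> \<gamma> x"
    and max: "\<And>x. x \<in> {b..a} \<Longrightarrow> \<gamma> x \<bullet> cis \<psi> \<le> \<gamma> s \<bullet> cis \<psi>"
  obtains i j :: int where "j \<le> i" "\<bar>B b s - (\<psi> + 2 * pi * i)\<bar> \<le> pi/2" "\<bar>B s a - pi - (\<psi> + 2 * pi * j)\<bar> \<le> pi/2"
proof -
  have c1: "cos (B x s - \<psi>) \<ge> 0" if "x \<in> {b..<s}" for x
  proof -
    have "(\<gamma> s - \<gamma> x) \<bullet> cis \<psi> = cmod (\<gamma> s - \<gamma> x) * cos (B x s - \<psi>)"
      using that s by (intro has_arg_inner B) auto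
    moreover have "(\<gamma> s - \<gamma> x) \<bullet> cis \<psi> \<ge> 0" using max[of x] that s by (simp add: inner_diff_left)
    moreover have "cmod (\<gamma> s - \<gamma> x) > 0" using inj[of x s] that s by auto
    ultimately show ?thesis by (simp add: zero_le_mult_iff)
  qed
  have c2: "cos (B s y - \<psi>) \<le> 0" if "y \<in> {s<..a}" for y
  proof -
    have "(\<gamma> y - \<gamma> s) \<bullet> cis \<psi> = cmod (\<gamma> y - \<gamma> s) * cos (B s y - \<psi>)"
      using that s by (intro has_arg_inner B) auto
    moreover have "(\<gamma> y - \<gamma> s) \<bullet> cis \<psi> \<le> 0" using max[of y] that s by (simp add: inner_diff_left)
    moreover have "cmod (\<gamma> y - \<gamma> s) > 0" using inj[of s y] that s by auto
    ultimately show ?thesis by (simp add: mult_le_0_iff)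
  qed
  have d1: "cos (B x s - \<psi>) \<ge> 0" if "x \<in> {b..s}" for x
  proof (rule continuous_ge_on_closure[of "{b..<s}" "\<lambda>x. cos (B x s - \<psi>)"])
    show "continuous_on (closure {b..<s}) (\<lambda>x. cos (B x s - \<psi>))"
      using s cB1 by (auto intro!: continuous_intros)
  qed (use s that c1 in auto)
  have d2: "cos (B s y - \<psi>) \<le> 0" if "y \<in> {s..a}" for y
  proof (rule continuous_le_on_closure[of "{s<..a}" "\<lambda>y. cos (B s y - \<psi>)"])
    show "continuous_on (closure {s<..a}) (\<lambda>y. cos (B s y - \<psi>))"
      using s cB2 by (auto intro!: continuous_intros)
  qed (use s that c2 in auto)
  have "cos (B s s - \<psi>) = 0" using d1[of s] d2[of s] s by force
  then obtain n :: int where n: "odd n" "B s s - \<psi> = of_int n * (pi/2)"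
    using cos_zero_iff_int by blast
  \<comment> \<open>The tangent is orthogonal to \<open>cis \<psi>\<close>; the two cases are its two orientations.\<close>
  obtain i :: int where i: "\<bar>B s s - (\<psi> + 2 * pi * i)\<bar> = pi/2"
    and j: "\<bar>B s s - pi - (\<psi> + 2 * pi * i)\<bar> = pi/2 \<or> \<bar>B s s - pi - (\<psi> + 2 * pi * (i-1))\<bar> = pi/2"
  proof (cases "n mod 4 = 1")
    case True
    define i where "i = n div 4"
    have "n = 4 * i + 1" using True unfolding i_def by presburger
    then have "B s s = \<psi> + 2 * pi * i + pi/2" using n(2) by (simp add: algebra_simps)
    then show ?thesis by (intro that[of i]) auto
  next
    case False
    define i where "i = (n + 1) div 4"
    have "n = 4 * i - 1" using False n(1) unfolding i_def by presburger
    then have "B s s = \<psi> + 2 * pi * i - pi/2" using n(2) by (simp add: left_diff_distrib) (simp add: algebra_simps)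
    then have e: "B s s - (\<psi> + 2 * pi * i) = - (pi/2)" "B s s - pi - (\<psi> + 2 * pi * of_int (i - 1)) = pi/2"
      by (simp_all add: right_diff_distrib)
    show ?thesis
      by (rule that[of i]) (simp_all only: e abs_minus_cancel, simp_all)
  qed
  then obtain j :: int where ji: "j \<le> i" and j: "\<bar>B s s - pi - (\<psi> + 2 * pi * j)\<bar> = pi/2"
    by (metis diff_le_eq less_add_one order_le_less order_refl zle_diff1_eq)
  have sh: "cos (x - (\<psi> + 2 * pi * of_int k)) = cos (x - \<psi>)" for x and k :: int
    using cos_int_2pin[of k] sin_int_2pin[of k] by (simp add: diff_diff_eq[symmetric] cos_diff[of _ "2 * pi * of_int k"])
  have "\<bar>B b s - (\<psi> + 2 * pi * i)\<bar> \<le> pi/2"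
    by (rule abs_le_half_pi_on_connected[of "{b..s}" "\<lambda>x. B x s - (\<psi> + 2 * pi * i)" s])
       (use s d1 i sh in \<open>auto intro!: continuous_intros cB1\<close>)
  moreover have "\<bar>B s a - pi - (\<psi> + 2 * pi * j)\<bar> \<le> pi/2"
  proof (rule abs_le_half_pi_on_connected[of "{s..a}" "\<lambda>y. B s y - pi - (\<psi> + 2 * pi * j)" s])
    show "cos (B s y - pi - (\<psi> + 2 * pi * j)) \<ge> 0" if "y \<in> {s..a}" for y
    proof -
      have "cos (B s y - pi - (\<psi> + 2 * pi * j)) = cos ((B s y - \<psi>) - pi)"
        using sh[of "B s y - pi" j] by (simp add: algebra_simps)
      also have "\<dots> = - cos (B s y - \<psi>)" by (simp add: cos_diff)
      finally show ?thesis using d2[OF that] by simp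
    qed
  qed (use s j in \<open>auto intro!: continuous_intros cB2\<close>)
  ultimately show thesis using that ji by blast
qed

section \<open>The taut string bound\<close>

text \<open>Used to see that an extremal point of a curve is not an end point: in a direction in which some other
point \<open>v\<close> of the curve is seen from the centre of the disc, the tangency point \<open>w\<close> of that disc is not
maximal.\<close>

lemma touching_point_strictly_lower:
  assumes "t > 0" "cmod w = t" "t \<le> cmod v" "has_arg v \<psi>" "v \<noteq> w"
  shows "w \<bullet> cis \<psi> < v \<bullet> cis \<psi>"
proof -
  have "v \<bullet> (v - w) > 0" using assms by (intro tangent_disc_inner_pos) auto
  moreover have "v \<bullet> (v - w) = cmod v * (cis \<psi> \<bullet> (v - w))"
    using assms(4) inner_of_real_mult unfolding has_arg_def by metis
  ultimately have "cis \<psi> \<bullet> (v - w) > 0" using assms by (simp add: zero_less_mult_iff)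
  then show ?thesis by (simp add: inner_diff_right inner_commute)
qed

lemma cos_pos_near_period:
  assumes "cos x > 0"
  obtains k :: int where "\<bar>x - 2 * pi * k\<bar> < pi/2"
proof -
  define k where "k = round (x / (2*pi))"
  have "\<bar>of_int k - x / (2*pi)\<bar> \<le> 1/2" unfolding k_def by (rule of_int_round_abs_le)
  then have "2 * pi * \<bar>of_int k - x / (2*pi)\<bar> \<le> pi" using pi_gt_zero by simp
  also have "2 * pi * \<bar>of_int k - x / (2*pi)\<bar> = \<bar>2 * pi * (of_int k - x / (2*pi))\<bar>" by (simp add: abs_mult)
  also have "2 * pi * (of_int k - x / (2*pi)) = - (x - 2 * pi * k)" by (simp add: right_diff_distrib)
  finally have "\<bar>x - 2 * pi * k\<bar> \<le> pi" by (simp only: abs_minus_cancel)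
  moreover have "cos (x - 2 * pi * of_int k) > 0"
    unfolding cos_diff[of x] cos_int_2pin sin_int_2pin using assms by simp
  moreover have "pi < 3*pi/2" using pi_gt_zero by simp
  ultimately have "\<bar>x - 2 * pi * k\<bar> < pi/2" by (intro abs_less_half_pi_if_cos_pos) linarith+
  then show thesis using that by blast
qed

text \<open>For unit speed the right-hand side is the length of the arc minus \<open>t\<close> times the turning of its tangent. For \<open>p \<noteq> q\<close> the cases
below follow the position of the ray of argument \<open>\<psi>\<close>, orthogonal to \<open>q - p\<close> and on its right, where the
tight string leaves the first circle and where it reaches the second one. The angle \<open>\<alpha>\<close> is the position
of \<open>\<gamma> b\<close> on the first circle, \<open>\<beta>\<close> the position of \<open>\<gamma> a\<close> on the second. If \<open>\<psi>\<close> does not lie strictly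
between \<open>\<alpha>\<close> and \<open>\<beta>\<close>, splitting at an end point is enough. Otherwise the curve is split at a point
extremal in direction \<open>cis \<psi>\<close>.\<close>

lemma chord_turning_bound:
  fixes \<gamma> \<gamma>' :: "real \<Rightarrow> complex" and B :: "real \<Rightarrow> real \<Rightarrow> real"
  assumes ba: "b < a" and t: "t > 0"
    and deriv: "\<And>s. s \<in> {b..a} \<Longrightarrow> (\<gamma> has_vector_derivative \<gamma>' s) (at s within {b..a})"
    and cont: "continuous_on {b..a} \<gamma>'" and speed: "\<And>s. s \<in> {b..a} \<Longrightarrow> cmod (\<gamma>' s) \<le> 1"
    and cB: "continuous_on {(x, y). b \<le> x \<and> x \<le> y \<and> y \<le> a} (\<lambda>(x, y). B x y)"
    and B: "\<And>x y. b \<le> x \<Longrightarrow> x < y \<Longrightarrow> y \<le> a \<Longrightarrow> has_arg (\<gamma> y - \<gamma> x) (B x y)"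
    and inj: "\<And>x y. b \<le> x \<Longrightarrow> x < y \<Longrightarrow> y \<le> a \<Longrightarrow> \<gamma> y \<noteq> \<gamma> x"
    and p: "p = \<gamma> b + of_real t * (\<i> * cis (B b b))" and q: "q = \<gamma> a + of_real t * (\<i> * cis (B a a))"
    and dp: "\<And>s. s \<in> {b..a} \<Longrightarrow> t \<le> cmod (\<gamma> s - p)"
    and dq: "\<And>s. s \<in> {b..a} \<Longrightarrow> t \<le> cmod (\<gamma> s - q)"
  shows "cmod (q - p) \<le> (a - b) - t * (B a a - B b b)"
proof -
  define \<alpha> \<beta> where "\<alpha> = B b b - pi/2" and "\<beta> = B a a - pi/2"
  have cB1: "continuous_on {b..s} (\<lambda>x. B x s)" if "s \<in> {b..a}" for s
  proof -
    have "continuous_on {b..s} (\<lambda>x. (\<lambda>(x, y). B x y) (x, s))"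
      by (rule continuous_on_compose2[OF cB]) (use that in \<open>auto intro!: continuous_on_Pair continuous_on_id continuous_on_const\<close>)
    then show ?thesis by simp
  qed
  have cB2: "continuous_on {s..a} (B s)" if "s \<in> {b..a}" for s
  proof -
    have "continuous_on {s..a} (\<lambda>y. (\<lambda>(x, y). B x y) (s, y))"
      by (rule continuous_on_compose2[OF cB]) (use that in \<open>auto intro!: continuous_on_Pair continuous_on_id continuous_on_const\<close>)
    then show ?thesis by simp
  qed
  have pb: "\<gamma> b - p = of_real t * cis \<alpha>" unfolding p \<alpha>_def
    by (simp add: complex_eq_iff cos_diff sin_diff)
  have qa: "\<gamma> a - q = of_real t * cis \<beta>" unfolding q \<beta>_def
    by (simp add: complex_eq_iff cos_diff sin_diff)
  have npb: "cmod (\<gamma> b - p) = t" and nqa: "cmod (\<gamma> a - q) = t"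
    using t by (simp_all add: pb qa norm_mult)
  have lip: "cmod (\<gamma> r - \<gamma> s) \<le> \<bar>r - s\<bar>" if "r \<in> {b..a}" "s \<in> {b..a}" for r s
  proof -
    have "cmod (\<gamma> r - \<gamma> s) \<le> 1 * norm (r - s)"
    proof (rule differentiable_bound[of "{b..a}"])
      fix u assume u: "u \<in> {b..a}"
      show "(\<gamma> has_derivative (\<lambda>h. h *\<^sub>R \<gamma>' u)) (at u within {b..a})"
        using deriv[OF u] by (simp add: has_vector_derivative_def)
      show "onorm (\<lambda>h. h *\<^sub>R \<gamma>' u) \<le> 1"
        using speed[OF u] by (intro onorm_le) (auto intro: mult_left_le)
    qed (use that in auto)
    then show ?thesis by simp
  qed
  obtain P where P: "continuous_on {b..a} P" "P b = \<alpha>" "\<And>s. s \<in> {b..a} \<Longrightarrow> has_arg (\<gamma> s - p) (P s)"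
    and Plip: "\<And>r s. r \<in> {b..a} \<Longrightarrow> s \<in> {b..a} \<Longrightarrow> t * \<bar>P r - P s\<bar> \<le> \<bar>r - s\<bar>"
  proof (rule arg_lift[of b b a "\<lambda>s. \<gamma> s - p" \<gamma>' \<alpha>])
    show "((\<lambda>s. \<gamma> s - p) has_vector_derivative \<gamma>' s) (at s within {b..a})" if "s \<in> {b..a}" for s
      using has_vector_derivative_diff_const deriv[OF that] by fastforce
    show "\<gamma> s - p \<noteq> 0" if "s \<in> {b..a}" for s using dp[OF that] t by auto
    show "has_arg (\<gamma> b - p) \<alpha>" using pb t by (intro has_arg_I) auto
  qed (use ba cont speed dp t in auto)
  obtain Q where Q: "continuous_on {b..a} Q" "Q a = \<beta>" "\<And>s. s \<in> {b..a} \<Longrightarrow> has_arg (\<gamma> s - q) (Q s)"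
    and Qlip: "\<And>r s. r \<in> {b..a} \<Longrightarrow> s \<in> {b..a} \<Longrightarrow> t * \<bar>Q r - Q s\<bar> \<le> \<bar>r - s\<bar>"
  proof (rule arg_lift[of a b a "\<lambda>s. \<gamma> s - q" \<gamma>' \<beta>])
    show "((\<lambda>s. \<gamma> s - q) has_vector_derivative \<gamma>' s) (at s within {b..a})" if "s \<in> {b..a}" for s
      using has_vector_derivative_diff_const deriv[OF that] by fastforce
    show "\<gamma> s - q \<noteq> 0" if "s \<in> {b..a}" for s using dq[OF that] t by auto
    show "has_arg (\<gamma> a - q) \<beta>" using qa t by (intro has_arg_I) auto
  qed (use ba cont speed dq t in auto)
  have PB: "\<bar>P s - B b s\<bar> < pi/2" if "s \<in> {b<..a}" for s
    by (rule arg_near_chord_from_start(2)[of b a "B b" \<gamma> P p t s])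
      (use ba cB2[of b] B inj P npb dp t that in \<open>auto simp: \<alpha>_def\<close>)
  have ine: "\<gamma> s \<noteq> \<gamma> a" if "s \<in> {b..<a}" for s using inj[of s a] that by simp
  have QB: "\<bar>Q s - (B s a - pi)\<bar> < pi/2" if "s \<in> {b..<a}" for s
    by (rule arg_near_chord_to_end(2)[of b a "\<lambda>s. B s a" \<gamma> Q q t s])
      (use ba cB1[of a] B ine Q nqa dq t that in \<open>auto simp: \<beta>_def\<close>)
  have H1: "t * (c - \<alpha>) + (\<gamma> s - p) \<bullet> (\<i> * cis c) \<le> s - b"
    if s: "s \<in> {b..a}" and c: "c \<le> \<alpha> \<or> c \<le> P s \<or> (\<bar>P s - c\<bar> < pi/2 \<and> (\<gamma> s - p) \<bullet> cis c \<ge> t)" for s c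
  proof -
    have "continuous_on {b..s} P" by (rule continuous_on_subset[OF P(1)]) (use s in auto)
    then show ?thesis
      using turning_estimate[of b s t "\<lambda>s. \<gamma> s - p" P c] s c t lip P Plip npb by auto
  qed
  \<comment> \<open>The estimate for the last part: reverse time and reflect, which keeps the disc on the left.\<close>
  have H2: "t * (\<beta> - c) + (q - \<gamma> s) \<bullet> (\<i> * cis c) \<le> a - s"
    if s: "s \<in> {b..a}" and c: "\<beta> \<le> c \<or> Q s \<le> c \<or> (\<bar>Q s - c\<bar> < pi/2 \<and> (\<gamma> s - q) \<bullet> cis c \<ge> t)" for s c
  proof -
    have "t * (- c - (- Q (a - 0))) + cnj (\<gamma> (a - (a - s)) - q) \<bullet> (\<i> * cis (- c)) \<le> (a - s) - 0"
    proof (rule turning_estimate[of 0 "a - s" t "\<lambda>r. cnj (\<gamma> (a - r) - q)" "\<lambda>r. - Q (a - r)" "- c"])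
      show "cmod (cnj (\<gamma> (a - r) - q) - cnj (\<gamma> (a - r') - q)) \<le> \<bar>r - r'\<bar>"
        if "r \<in> {0..a - s}" "r' \<in> {0..a - s}" for r r'
      proof -
        have "cnj (\<gamma> (a - r) - q) - cnj (\<gamma> (a - r') - q) = cnj (\<gamma> (a - r) - \<gamma> (a - r'))" by simp
        then show ?thesis using lip[of "a - r" "a - r'"] that s by (simp del: complex_cnj_diff)
      qed
      show "has_arg (cnj (\<gamma> (a - r) - q)) (- Q (a - r))" if "r \<in> {0..a - s}" for r
        using that s by (intro has_arg_cnj Q) auto
      show "t * \<bar>- Q (a - r) - - Q (a - r')\<bar> \<le> \<bar>r - r'\<bar>"
        if "r \<in> {0..a - s}" "r' \<in> {0..a - s}" for r r'
        using Qlip[of "a - r" "a - r'"] that s by (simp add: abs_minus_commute)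
      show "continuous_on {0..a - s} (\<lambda>r. - Q (a - r))"
        using s by (intro continuous_intros continuous_on_compose2[OF Q(1)]) auto
      show "- c \<le> - Q (a - 0) \<or> - c \<le> - Q (a - (a - s)) \<or>
          \<bar>- Q (a - (a - s)) - - c\<bar> < pi / 2 \<and> t \<le> cnj (\<gamma> (a - (a - s)) - q) \<bullet> cis (- c)"
        using c Q(2) by (auto simp: inner_cnj_cis abs_minus_commute simp del: complex_cnj_diff)
      show "cmod (cnj (\<gamma> (a - 0) - q)) = t" using nqa by (simp only: complex_mod_cnj diff_zero)
    qed (use s t in auto)
    then have "t * (\<beta> - c) - (\<gamma> s - q) \<bullet> (\<i> * cis c) \<le> a - s"
      using Q(2) by (simp add: inner_cnj_cis del: complex_cnj_diff)
    then show ?thesis by (simp add: inner_diff_left)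
  qed
  have cis_shift: "cis (\<psi> + 2 * pi * of_int k) = cis \<psi>" for \<psi> and k :: int
    by (simp add: cis_mult[symmetric] cis_multiple_2pi)
  \<comment> \<open>Splitting at \<open>s\<close>, with the angles from \<open>p\<close> and \<open>q\<close> on sheets \<open>i\<close> and \<open>j\<close>: for \<open>j \<le> i\<close> the surplus \<open>2\<pi>t (i - j)\<close> only helps.\<close>
  have combine: "(q - p) \<bullet> (\<i> * cis \<psi>) \<le> (a - b) - t * (B a a - B b b)"
    if s: "s \<in> {b..a}" and ji: "(j::int) \<le> i"
      and 1: "t * (\<psi> + 2 * pi * i - \<alpha>) + (\<gamma> s - p) \<bullet> (\<i> * cis (\<psi> + 2 * pi * i)) \<le> s - b"
      and 2: "t * (\<beta> - (\<psi> + 2 * pi * j)) + (q - \<gamma> s) \<bullet> (\<i> * cis (\<psi> + 2 * pi * j)) \<le> a - s" for \<psi> s i j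
  proof -
    have "t * (2 * pi * of_int j) \<le> t * (2 * pi * of_int i)" using ji t by simp
    moreover have "(\<gamma> s - p) \<bullet> (\<i> * cis \<psi>) + (q - \<gamma> s) \<bullet> (\<i> * cis \<psi>) = (q - p) \<bullet> (\<i> * cis \<psi>)"
      by (simp add: inner_diff_left)
    moreover have "t * (\<psi> + 2 * pi * i - \<alpha>) + t * (\<beta> - (\<psi> + 2 * pi * j)) =
        t * (B a a - B b b) + (t * (2 * pi * of_int i) - t * (2 * pi * of_int j))"
      unfolding \<alpha>_def \<beta>_def by (simp add: algebra_simps)
    ultimately show ?thesis using 1 2 unfolding cis_shift by linarith
  qed
  have extremal: "(q - p) \<bullet> (\<i> * cis \<psi>) \<le> (a - b) - t * (B a a - B b b)"
    if s1: "s1 \<in> {b<..a}" "has_arg (\<gamma> s1 - p) \<psi>" and s2: "s2 \<in> {b..<a}" "has_arg (\<gamma> s2 - q) \<psi>"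
      and orth: "(q - p) \<bullet> cis \<psi> = 0" for s1 s2 \<psi>
  proof -
    have cg: "continuous_on {b..a} \<gamma>"
      using deriv by (meson continuous_on_eq_continuous_within has_vector_derivative_continuous)
    have "\<exists>s\<in>{b..a}. \<forall>x\<in>{b..a}. \<gamma> x \<bullet> cis \<psi> \<le> \<gamma> s \<bullet> cis \<psi>"
      using ba cg by (intro continuous_attains_sup) (auto intro!: continuous_intros)
    then obtain s where s: "s \<in> {b..a}" and max: "\<And>x. x \<in> {b..a} \<Longrightarrow> \<gamma> x \<bullet> cis \<psi> \<le> \<gamma> s \<bullet> cis \<psi>"
      by blast
    have "s \<noteq> b"
      using touching_point_strictly_lower[of t "\<gamma> b - p" "\<gamma> s1 - p" \<psi>] t npb dp[of s1] s1 inj[of b s1] max[of s1]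
      by (auto simp: inner_diff_left)
    moreover have "s \<noteq> a"
      using touching_point_strictly_lower[of t "\<gamma> a - q" "\<gamma> s2 - q" \<psi>] t nqa dq[of s2] s2 inj[of s2 a] max[of s2]
      by (auto simp: inner_diff_left)
    ultimately have sba: "b < s" "s < a" using s by auto
    obtain i j :: int where ji: "j \<le> i" and i: "\<bar>B b s - (\<psi> + 2 * pi * i)\<bar> \<le> pi/2"
      and j: "\<bar>B s a - pi - (\<psi> + 2 * pi * j)\<bar> \<le> pi/2"
      by (rule chord_sheets_at_extremum[of b s a B \<gamma> \<psi>]) (use sba cB1 cB2 B inj max s in auto)
    \<comment> \<open>The extremal point is at least as far out as \<open>\<gamma> s1\<close>, which is seen from \<open>p\<close> exactly in direction \<open>cis \<psi>\<close>.\<close>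
    have depth: "(\<gamma> s - p) \<bullet> cis \<psi> \<ge> t"
      using has_arg_inner(1)[OF s1(2), of \<psi>] dp[of s1] s1 max[of s1] by (simp add: inner_diff_left)
    have depth': "(\<gamma> s - q) \<bullet> cis \<psi> \<ge> t"
      using depth orth by (simp add: inner_diff_left)
    have "\<bar>P s - (\<psi> + 2 * pi * i)\<bar> < pi/2"
    proof (rule abs_less_half_pi_if_cos_pos)
      have "cmod (\<gamma> s - p) * cos (P s - (\<psi> + 2 * pi * i)) > 0"
        using has_arg_inner(1)[OF P(3)[OF s], of "\<psi> + 2 * pi * i"] depth t cis_shift by simp
      then show "cos (P s - (\<psi> + 2 * pi * i)) > 0" by (rule pos_of_norm_mult_pos)
      show "\<bar>P s - (\<psi> + 2 * pi * i)\<bar> < 3 * pi/2"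
      proof -
        have "\<bar>P s - B b s\<bar> < pi/2" using PB sba by simp
        then show ?thesis using i by linarith
      qed
    qed
    then have 1: "t * (\<psi> + 2 * pi * i - \<alpha>) + (\<gamma> s - p) \<bullet> (\<i> * cis (\<psi> + 2 * pi * i)) \<le> s - b"
      using H1[OF s, of "\<psi> + 2 * pi * i"] depth cis_shift by simp
    have "\<bar>Q s - (\<psi> + 2 * pi * j)\<bar> < pi/2"
    proof (rule abs_less_half_pi_if_cos_pos)
      have "cmod (\<gamma> s - q) * cos (Q s - (\<psi> + 2 * pi * j)) > 0"
        using has_arg_inner(1)[OF Q(3)[OF s], of "\<psi> + 2 * pi * j"] depth' t cis_shift by simp
      then show "cos (Q s - (\<psi> + 2 * pi * j)) > 0" by (rule pos_of_norm_mult_pos)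
      show "\<bar>Q s - (\<psi> + 2 * pi * j)\<bar> < 3 * pi/2"
      proof -
        have "\<bar>Q s - (B s a - pi)\<bar> < pi/2" using QB sba by simp
        then show ?thesis using j by linarith
      qed
    qed
    then have 2: "t * (\<beta> - (\<psi> + 2 * pi * j)) + (q - \<gamma> s) \<bullet> (\<i> * cis (\<psi> + 2 * pi * j)) \<le> a - s"
      using H2[OF s, of "\<psi> + 2 * pi * j"] depth' cis_shift by simp
    show ?thesis by (rule combine[OF s ji 1 2])
  qed
  show ?thesis
  proof (cases "p = q")
    case True
    \<comment> \<open>With one disc every direction is orthogonal to \<open>q - p = 0\<close>; take one in which some inner point is seen.\<close>
    define s0 where "s0 = (a + b) / 2"
    obtain \<psi> where "has_arg (\<gamma> s0 - p) \<psi>" using has_arg_exists by blast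
    then show ?thesis using extremal[of s0 \<psi> s0] True ba unfolding s0_def by simp
  next
    case False
    have ab: "a \<in> {b..a}" "b \<in> {b..a}" "a \<in> {b<..a}" "b \<in> {b..<a}" using ba by auto
    obtain \<phi>0 where \<phi>0: "has_arg (q - p) \<phi>0" using has_arg_exists by blast
    have "(\<gamma> a - p) \<bullet> ((\<gamma> a - p) - (\<gamma> a - q)) > 0"
      using dp[OF ab(1)] nqa False by (intro tangent_disc_inner_pos[of t]) auto
    then have "cmod (\<gamma> a - p) * cmod (q - p) * cos (P a - \<phi>0) > 0"
      using has_arg_inner2[OF P(3)[OF ab(1)] \<phi>0] by simp
    then have "cos (P a - \<phi>0) > 0" by (auto simp only: mult.assoc dest!: pos_of_norm_mult_pos)
    \<comment> \<open>The argument of \<open>q - p\<close> is chosen close to the angle under which \<open>p\<close> sees the end of the curve; by the chord from \<open>\<gamma> b\<close> to \<open>\<gamma> a\<close> it is then also close to the angle under which \<open>q\<close> sees the beginning.\<close>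
    then obtain k :: int where k: "\<bar>P a - \<phi>0 - 2 * pi * k\<bar> < pi/2" using cos_pos_near_period by blast
    define \<phi> where "\<phi> = \<phi>0 + 2 * pi * k"
    have \<phi>: "has_arg (q - p) \<phi>" using has_arg_add_int[OF \<phi>0] unfolding \<phi>_def .
    have Pa: "\<bar>P a - \<phi>\<bar> < pi/2" using k unfolding \<phi>_def by (simp add: algebra_simps)
    have "\<bar>Q b - (\<phi> - pi)\<bar> < pi/2"
    proof (rule abs_less_half_pi_if_cos_pos)
      have "(\<gamma> b - q) \<bullet> ((\<gamma> b - q) - (\<gamma> b - p)) > 0"
        using dq[OF ab(2)] npb False by (intro tangent_disc_inner_pos[of t]) auto
      then have "cmod (\<gamma> b - q) * cmod (p - q) * cos (Q b - (\<phi> - pi)) > 0"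
        using has_arg_inner2[OF Q(3)[OF ab(2)] has_arg_uminus[OF \<phi>]] by simp
      then show "cos (Q b - (\<phi> - pi)) > 0" by (auto simp only: mult.assoc dest!: pos_of_norm_mult_pos)
      show "\<bar>Q b - (\<phi> - pi)\<bar> < 3 * pi/2" using QB[OF ab(4)] PB[OF ab(3)] Pa by linarith
    qed
    then have Qb: "Q b < \<phi> - pi/2" by linarith
    define \<psi> where "\<psi> = \<phi> - pi/2"
    have Pa': "\<psi> < P a" and Qb': "Q b < \<psi>" using Pa Qb unfolding \<psi>_def by linarith+
    have len: "(q - p) \<bullet> (\<i> * cis \<psi>) = cmod (q - p)"
      using has_arg_inner(2)[OF \<phi>, of \<psi>] unfolding \<psi>_def by simp
    have orth: "(q - p) \<bullet> cis \<psi> = 0"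
      using has_arg_inner(1)[OF \<phi>, of \<psi>] unfolding \<psi>_def by simp
    consider "\<beta> \<le> \<psi>" | "\<psi> \<le> \<alpha>" | "\<alpha> < \<psi>" "\<psi> < \<beta>" by linarith
    then have "(q - p) \<bullet> (\<i> * cis \<psi>) \<le> (a - b) - t * (B a a - B b b)"
    proof cases
      case 1
      then show ?thesis using combine[OF ab(1), of 0 0 \<psi>] H1[OF ab(1), of \<psi>] H2[OF ab(1), of \<psi>] Pa' by simp
    next
      case 2
      then show ?thesis using combine[OF ab(2), of 0 0 \<psi>] H1[OF ab(2), of \<psi>] H2[OF ab(2), of \<psi>] Qb' by simp
    next
      case 3
      obtain s1 where s1: "b \<le> s1" "s1 \<le> a" "P s1 = \<psi>"
        using IVT'[of P b \<psi> a] 3 Pa' P ba by auto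
      obtain s2 where s2: "b \<le> s2" "s2 \<le> a" "Q s2 = \<psi>"
        using IVT'[of Q b \<psi> a] 3 Qb' Q ba by auto
      have "s1 \<noteq> b" "s2 \<noteq> a" using s1 s2 P Q 3 by auto
      then show ?thesis using extremal[of s1 \<psi> s2] s1 s2 P(3)[of s1] Q(3)[of s2] orth by auto
    qed
    then show ?thesis using len by simp
  qed
qed

section \<open>A continuous angle for the chords of a closed curve\<close>

lemma constant_mod_period:
  fixes f :: "'a::topological_space \<Rightarrow> real"
  assumes "connected S" "continuous_on S f" "\<And>x. x \<in> S \<Longrightarrow> \<exists>k::int. f x = d + 2 * pi * k"
    and "x \<in> S" "y \<in> S"
  shows "f x = f y"
proof -
  have "f constant_on S"
  proof (rule continuous_discrete_range_constant[OF assms(1,2)])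
    fix x assume x: "x \<in> S"
    show "\<exists>e>0. \<forall>y. y \<in> S \<and> f y \<noteq> f x \<longrightarrow> e \<le> norm (f y - f x)"
    proof (intro exI[of _ "2*pi"] conjI allI impI)
      fix y assume y: "y \<in> S \<and> f y \<noteq> f x"
      obtain k l :: int where "f x = d + 2 * pi * k" "f y = d + 2 * pi * l" using assms(3) x y by metis
      then have e: "f y - f x = 2 * pi * of_int (l - k)" and "l \<noteq> k" using y by (auto simp: algebra_simps)
      then have "1 \<le> \<bar>real_of_int (l - k)\<bar>" by linarith
      then have "2 * pi * 1 \<le> 2 * pi * \<bar>real_of_int (l - k)\<bar>" by (intro mult_left_mono) auto
      then show "2 * pi \<le> norm (f y - f x)" unfolding e by (simp add: abs_mult)
    qed simp
  qed
  then show ?thesis using assms(4,5) unfolding constant_on_def by auto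
qed

lemma periodic_reduce:
  fixes \<gamma> :: "real \<Rightarrow> 'a"
  assumes per: "\<And>s. \<gamma> (s + L) = \<gamma> s" and L: "L > 0"
  obtains k :: int where "x + of_int k * L \<in> {0..<L}" "\<gamma> (x + of_int k * L) = \<gamma> x"
proof (rule that[of "- \<lfloor>x / L\<rfloor>"])
  interpret periodic_fun_simple \<gamma> L by unfold_locales (rule per)
  show "\<gamma> (x + of_int (- \<lfloor>x / L\<rfloor>) * L) = \<gamma> x" by (rule plus_of_int)
  have "of_int \<lfloor>x / L\<rfloor> \<le> x / L" "x / L < of_int \<lfloor>x / L\<rfloor> + 1" by linarith+
  then have "of_int \<lfloor>x / L\<rfloor> * L \<le> x" "x < (of_int \<lfloor>x / L\<rfloor> + 1) * L"
    by (simp_all only: pos_le_divide_eq[OF L] pos_divide_less_eq[OF L])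
  then show "x + of_int (- \<lfloor>x / L\<rfloor>) * L \<in> {0..<L}" by (simp add: algebra_simps)
qed

lemma periodic_inj:
  fixes \<gamma> :: "real \<Rightarrow> 'a"
  assumes per: "\<And>s. \<gamma> (s + L) = \<gamma> s" and L: "L > 0" and inj: "inj_on \<gamma> {0..<L}"
    and xy: "x < y" "y < x + L"
  shows "\<gamma> y \<noteq> \<gamma> x"
proof
  assume e: "\<gamma> y = \<gamma> x"
  obtain k :: int where k: "x + of_int k * L \<in> {0..<L}" "\<gamma> (x + of_int k * L) = \<gamma> x"
    by (rule periodic_reduce[of \<gamma>, OF per L])
  obtain l :: int where l: "y + of_int l * L \<in> {0..<L}" "\<gamma> (y + of_int l * L) = \<gamma> y"
    by (rule periodic_reduce[of \<gamma>, OF per L])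
  have "\<gamma> (y + of_int l * L) = \<gamma> (x + of_int k * L)" unfolding k(2) l(2) by (rule e)
  then have "y + of_int l * L = x + of_int k * L" using inj_onD[OF inj] k(1) l(1) by blast
  then have eq: "y - x = of_int (k - l) * L" by (simp add: algebra_simps)
  have "0 < of_int (k - l) * L" "of_int (k - l) * L < 1 * L" unfolding eq[symmetric] using xy by auto
  then have "0 < real_of_int (k - l)" "real_of_int (k - l) < 1"
    using mult_less_cancel_right_pos[OF L, of "of_int (k - l)" 1] zero_less_mult_pos2[OF _ L] by blast+
  then have "0 < k - l" "k - l < 1" by (simp_all only: of_int_0_less_iff of_int_less_1_iff)
  then show False by linarith
qed

text \<open>The difference quotient of \<open>\<gamma>\<close> extends continuously to the diagonal by \<open>\<gamma>'\<close> and has no zeros on the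
convex strip \<open>x \<le> y < x + L\<close>, so it has a continuous logarithm there.\<close>

lemma chord_arg_lift:
  fixes \<gamma> \<gamma>' :: "real \<Rightarrow> complex"
  assumes deriv: "\<And>s. (\<gamma> has_vector_derivative \<gamma>' s) (at s)" and cont: "continuous_on UNIV \<gamma>'"
    and speed: "\<And>s. cmod (\<gamma>' s) = 1"
    and L: "L > 0" and inj: "\<And>x y. x < y \<Longrightarrow> y < x + L \<Longrightarrow> \<gamma> y \<noteq> \<gamma> x"
  obtains B where "continuous_on {(x, y). x \<le> y \<and> y < x + L} (\<lambda>(x, y). B x y)"
    "\<And>x y. x < y \<Longrightarrow> y < x + L \<Longrightarrow> has_arg (\<gamma> y - \<gamma> x) (B x y)"
    "\<And>s. \<gamma>' s = cis (B s s)"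
proof -
  \<comment> \<open>The mean of \<open>\<gamma>'\<close> over the segment: the difference quotient, including its value on the diagonal.\<close>
  define F where "F = (\<lambda>z. integral (cbox 0 1) (\<lambda>u. \<gamma>' (fst z + u * (snd z - fst z))))"
  let ?W = "{(x, y). x \<le> y \<and> y < x + L}"
  have cF: "continuous_on ?W F" unfolding F_def
  proof (rule integral_continuous_on_param)
    show "continuous_on (?W \<times> cbox 0 1) (\<lambda>(z, u). \<gamma>' (fst z + u * (snd z - fst z)))"
      unfolding split_def by (rule continuous_on_compose2[OF cont]) (auto intro!: continuous_intros)
  qed
  have FD: "\<gamma> y - \<gamma> x = of_real (y - x) * F (x, y)" if "x \<le> y" for x y
  proof -
    have c: "((\<lambda>u. \<gamma> (x + u * (y - x))) has_vector_derivative (y - x) *\<^sub>R \<gamma>' (x + u * (y - x))) (at u within {0..1})" for u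
    proof -
      have "((\<lambda>u. x + u * (y - x)) has_vector_derivative (y - x)) (at u within {0..1})"
        by (auto intro!: derivative_eq_intros)
      from vector_diff_chain_within[OF this, of \<gamma> "\<gamma>' (x + u * (y - x))"] show ?thesis
        using has_vector_derivative_at_within[OF deriv] by (simp add: o_def)
    qed
    have "((\<lambda>u. (y - x) *\<^sub>R \<gamma>' (x + u * (y - x))) has_integral (\<gamma> (x + 1 * (y - x)) - \<gamma> (x + 0 * (y - x)))) {0..1}"
      by (rule fundamental_theorem_of_calculus) (use c in auto)
    then have "\<gamma> y - \<gamma> x = integral {0..1} (\<lambda>u. (y - x) *\<^sub>R \<gamma>' (x + u * (y - x)))"
      by (simp add: integral_unique[symmetric] del: integral_cmul)
    also have "\<dots> = (y - x) *\<^sub>R F (x, y)" unfolding F_def by simp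
    finally show ?thesis by (simp add: scaleR_conv_of_real)
  qed
  have Fd: "F (x, x) = \<gamma>' x" for x unfolding F_def by simp
  have nz: "F z \<noteq> 0" if z: "z \<in> ?W" for z
  proof (cases z)
    case (Pair x y)
    show ?thesis
    proof (cases "x = y")
      case True
      then show ?thesis using Pair Fd speed by (metis norm_zero zero_neq_one)
    next
      case False
      then have "x < y" "y < x + L" using z Pair by auto
      then show ?thesis using inj[of x y] FD[of x y] Pair by auto
    qed
  qed
  have "convex ?W"
  proof (rule convexI)
    fix z w u v assume "z \<in> ?W" "w \<in> ?W" and uv: "0 \<le> u" "0 \<le> v" "u + v = (1::real)"
    then obtain x y x' y' where zw: "z = (x, y)" "w = (x', y')" "x \<le> y" "y < x + L" "x' \<le> y'" "y' < x' + L" by auto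
    have "u * x + v * x' \<le> u * y + v * y'" using zw uv by (intro add_mono mult_left_mono) auto
    moreover have "u * (y - x) + v * (y' - x') < L"
      using uv zw by (intro convex_bound_lt) auto
    ultimately show "u *\<^sub>R z + v *\<^sub>R w \<in> ?W" using zw by (simp add: algebra_simps)
  qed
  then obtain G where G: "continuous_on ?W G" "\<And>z. z \<in> ?W \<Longrightarrow> F z = exp (G z)"
    using continuous_logarithm_on_contractible[OF cF convex_imp_contractible nz] by blast
  define B where "B x y = Im (G (x, y))" for x y
  show thesis
  proof (rule that[of B])
    have "(\<lambda>(x, y). B x y) = (\<lambda>z. Im (G z))" unfolding B_def by auto
    then show "continuous_on ?W (\<lambda>(x, y). B x y)" using G(1) by (simp add: continuous_on_Im)
    fix x y assume "x < y" "y < x + L"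
    then have "\<gamma> y - \<gamma> x = of_real (y - x) * exp (G (x, y))" using FD[of x y] G(2)[of "(x, y)"] by auto
    also have "\<dots> = of_real ((y - x) * exp (Re (G (x, y)))) * cis (B x y)" 
      unfolding B_def by (simp add: exp_eq_polar)
    finally show "has_arg (\<gamma> y - \<gamma> x) (B x y)"
      by (rule has_arg_I[rotated]) (use \<open>x < y\<close> in simp)
  next
    fix s
    have e: "\<gamma>' s = exp (G (s, s))" using Fd[of s] G(2)[of "(s, s)"] L by simp
    then have "exp (Re (G (s, s))) = 1" using speed[of s] by simp
    then show "\<gamma>' s = cis (B s s)" unfolding B_def e by (subst exp_eq_polar) simp
  qed
qed

text \<open>Interchanging the two ends of a chord, with one of them moved on by a period, changes \<open>B\<close> by a constant
odd multiple \<open>c\<close> of \<open>\<pi>\<close>. Doing this twice shows that the tangent angle grows by \<open>2c\<close> per period. The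
value \<open>c = \<pi>\<close> follows from the winding number about the centre \<open>p\<close> of an inscribed tangent disc: the
angle seen from \<open>p\<close> grows by \<open>2\<pi>\<close>, while it never differs by more than \<open>\<pi>/2\<close> from the angle of the
chord from \<open>\<gamma> b\<close>.\<close>

lemma tangent_turns_once:
  fixes \<gamma> \<gamma>' :: "real \<Rightarrow> complex"
  assumes deriv: "\<And>s. (\<gamma> has_vector_derivative \<gamma>' s) (at s)" and cont: "continuous_on UNIV \<gamma>'"
    and L: "L > 0" and per: "\<And>s. \<gamma> (s + L) = \<gamma> s"
    and inj: "\<And>x y. x < y \<Longrightarrow> y < x + L \<Longrightarrow> \<gamma> y \<noteq> \<gamma> x"
    and cB: "continuous_on {(x, y). x \<le> y \<and> y < x + L} (\<lambda>(x, y). B x y)"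
    and B: "\<And>x y. x < y \<Longrightarrow> y < x + L \<Longrightarrow> has_arg (\<gamma> y - \<gamma> x) (B x y)"
    and b: "0 \<le> b" "b \<le> L" and t: "t > 0" and p: "p = \<gamma> b + of_real t * (\<i> * cis (B b b))"
    and dp: "\<And>s. t \<le> cmod (\<gamma> s - p)"
    and wind: "winding_number (\<lambda>u. \<gamma> (L * u)) p = 1"
  shows "B (s + L) (s + L) = B s s + 2 * pi"
proof -
  have cB1: "continuous_on {x..y} (\<lambda>x. B (f x) (g x))"
    if "continuous_on {x..y} f" "continuous_on {x..y} g" "\<And>u. u \<in> {x..y} \<Longrightarrow> f u \<le> g u \<and> g u < f u + L" for x y :: real and f g
  proof -
    have "continuous_on {x..y} (\<lambda>x. (\<lambda>(x, y). B x y) (f x, g x))"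
      by (rule continuous_on_compose2[OF cB]) (use that in \<open>auto intro!: continuous_on_Pair\<close>)
    then show ?thesis by simp
  qed
  have cg: "continuous_on S \<gamma>" for S
    using deriv by (meson continuous_at_imp_continuous_on has_vector_derivative_continuous)
  let ?U = "{(x, y). x < y \<and> y < x + L}"
  have rev: "\<exists>k::int. B y (x + L) - B x y = - pi + 2 * pi * k" if "x < y" "y < x + L" for x y
  proof -
    have "has_arg (- (\<gamma> y - \<gamma> x)) (B x y - pi)" using B that by (intro has_arg_uminus) auto
    moreover have "- (\<gamma> y - \<gamma> x) = \<gamma> (x + L) - \<gamma> y" using per by simp
    moreover have "has_arg (\<gamma> (x + L) - \<gamma> y) (B y (x + L))" using B that by auto
    moreover have "\<gamma> (x + L) - \<gamma> y \<noteq> 0" using inj[of x y] that per by auto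
    ultimately obtain k :: int where "B y (x + L) = B x y - pi + 2 * pi * k"
      using has_arg_unique by metis
    then show ?thesis by (intro exI[of _ k]) simp
  qed
  have "convex ?U"
  proof (rule convexI)
    fix z w u v assume "z \<in> ?U" "w \<in> ?U" and uv: "0 \<le> u" "0 \<le> v" "u + v = (1::real)"
    then obtain x y x' y' where zw: "z = (x, y)" "w = (x', y')" "x < y" "y < x + L" "x' < y'" "y' < x' + L" by auto
    have "u * (x - y) + v * (x' - y') < 0"
      using uv zw by (intro convex_bound_lt) auto
    moreover have "u * (y - x) + v * (y' - x') < L"
      using uv zw by (intro convex_bound_lt) auto
    ultimately show "u *\<^sub>R z + v *\<^sub>R w \<in> ?U" using zw by (simp add: algebra_simps)
  qed
  then have conU: "connected ?U" by (rule convex_connected)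
  have cU: "continuous_on ?U (\<lambda>(x, y). B y (x + L) - B x y)"
  proof -
    have "continuous_on ?U (\<lambda>z. (\<lambda>(x, y). B x y) (snd z, fst z + L) - (\<lambda>(x, y). B x y) (fst z, snd z))"
      by (intro continuous_on_diff continuous_on_compose2[OF cB]) (auto intro!: continuous_intros)
    then show ?thesis by (simp add: split_def)
  qed
  \<comment> \<open>Any chord can serve to define the constant.\<close>
  define c where "c = B (L/2) (0 + L) - B 0 (L/2)"
  have c: "B y (x + L) = B x y + c" if "x < y" "y < x + L" for x y
  proof -
    have "(\<lambda>(x, y). B y (x + L) - B x y) (x, y) = (\<lambda>(x, y). B y (x + L) - B x y) (0, L/2)"
      by (rule constant_mod_period[OF conU cU, of "- pi"]) (use that L rev in auto)
    then show ?thesis unfolding c_def by simp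
  qed
  have c2: "B (x + L) (x + L) = B x x + 2 * c" for x
  proof -
    define f where "f y = B (x + L) (y + L) - B x y" for y
    have cf: "continuous_on {x..x + L/2} f" unfolding f_def
      using L by (intro continuous_on_diff cB1) (auto intro!: continuous_intros)
    have "f x = 2 * c"
    proof (rule continuous_constant_on_closure[of "{x<..x + L/2}" f])
      show "continuous_on (closure {x<..x + L/2}) f" using cf L by simp
      show "f y = 2 * c" if "y \<in> {x<..x + L/2}" for y
        using c[of x y] c[of y "x + L"] that L unfolding f_def by auto
      show "x \<in> closure {x<..x + L/2}" using L by simp
    qed
    then show ?thesis unfolding f_def by simp
  qed
  obtain A where A: "continuous_on {b..b + L} A" "A b = B b b - pi/2" "\<And>s. s \<in> {b..b + L} \<Longrightarrow> has_arg (\<gamma> s - p) (A s)"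
  proof (rule arg_lift[of b b "b + L" "\<lambda>s. \<gamma> s - p" \<gamma>' "B b b - pi/2"])
    show "((\<lambda>s. \<gamma> s - p) has_vector_derivative \<gamma>' s) (at s within {b..b + L})" for s
      using has_vector_derivative_at_within[OF has_vector_derivative_diff_const[THEN iffD2, OF deriv]] by simp
    show "\<gamma> s - p \<noteq> 0" for s using dp[of s] t by auto
    have "\<gamma> b - p = of_real t * cis (B b b - pi/2)"
      unfolding p by (simp add: complex_eq_iff cos_diff sin_diff)
    then show "has_arg (\<gamma> b - p) (B b b - pi/2)" using t by (intro has_arg_I) auto
    show "continuous_on {b..b + L} \<gamma>'" using cont continuous_on_subset by blast
  qed (use L in auto)
  have np: "p \<noteq> \<gamma> s" for s using dp[of s] t by auto
  have npb: "cmod (\<gamma> b - p) = t" unfolding p using t by (simp add: norm_mult)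
  have turn: "A (b + L) = A b + 2 * pi"
  proof -
    define g where "g = (\<lambda>u. \<gamma> (L * u))"
    have g: "path g" "pathfinish g = pathstart g" "p \<notin> path_image g"
    proof -
      show "path g" unfolding g_def path_def by (rule continuous_on_compose2[OF cg[of UNIV]]) (auto intro!: continuous_intros)
      show "pathfinish g = pathstart g" unfolding g_def pathfinish_def pathstart_def using per[of 0] by simp
      show "p \<notin> path_image g" unfolding g_def path_image_def using np by blast
    qed
    have sh: "shiftpath (b/L) g = (\<lambda>u. \<gamma> (b + L * u))"
    proof
      fix u
      have e: "L * (b/L + u) = b + L * u" "L * (b/L + u - 1) + L = b + L * u" using L by (simp_all add: algebra_simps)
      have "\<gamma> (L * (b/L + u - 1)) = \<gamma> (b + L * u)" using per[of "L * (b/L + u - 1)"] unfolding e(2) by simp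
      then show "shiftpath (b/L) g u = \<gamma> (b + L * u)" unfolding shiftpath_def g_def using e(1) by simp
    qed
    have bL: "b/L \<in> {0..1}" using b L by simp
    have "winding_number (shiftpath (b/L) g) p = winding_number g p"
      by (rule winding_number_shiftpath[OF g(1,3,2) bL])
    then have w: "winding_number (\<lambda>u. \<gamma> (b + L * u)) p = 1" using wind sh unfolding g_def by simp
    have "path (\<lambda>u. \<gamma> (b + L * u))" using path_shiftpath[OF g(1,2) bL] sh by simp
    moreover have "p \<notin> path_image (\<lambda>u. \<gamma> (b + L * u))" unfolding path_image_def using np by blast
    ultimately obtain q where q: "path q" "pathfinish q - pathstart q = 2 * of_real pi * \<i> * 1"
      "\<And>u. u \<in> {0..1} \<Longrightarrow> \<gamma> (b + L * u) = p + exp (q u)"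
      using winding_number_as_continuous_log w by metis
    have "A (b + L * 1) - Im (q 1) = A (b + L * 0) - Im (q 0)"
    proof (rule constant_mod_period[of "{0..1}" "\<lambda>u. A (b + L * u) - Im (q u)" 0])
      show "continuous_on {0..1} (\<lambda>u. A (b + L * u) - Im (q u))"
        using q(1) L unfolding path_def
        by (intro continuous_on_diff continuous_on_Im continuous_on_compose2[OF A(1)]) (auto intro!: continuous_intros)
      fix u :: real assume u: "u \<in> {0..1}"
      have "has_arg (\<gamma> (b + L * u) - p) (Im (q u))"
        by (rule has_arg_I[of "exp (Re (q u))"]) (use q(3)[OF u] in \<open>simp_all add: exp_eq_polar\<close>)
      moreover have "has_arg (\<gamma> (b + L * u) - p) (A (b + L * u))" using u L by (intro A) auto
      moreover have "\<gamma> (b + L * u) - p \<noteq> 0" using dp[of "b + L * u"] t by auto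
      ultimately obtain k :: int where "A (b + L * u) = Im (q u) + 2 * pi * k" using has_arg_unique by metis
      then show "\<exists>k::int. A (b + L * u) - Im (q u) = 0 + 2 * pi * k" by (intro exI[of _ k]) simp
    qed auto
    moreover have "Im (q 1) - Im (q 0) = 2 * pi"
      using arg_cong[OF q(2), of Im] unfolding pathfinish_def pathstart_def by simp
    ultimately show ?thesis by simp
  qed
  have near: "\<bar>A s - (B s (b + L) - c)\<bar> \<le> pi/2" if s: "s \<in> {b + L/2..<b + L}" for s
  proof -
    have "\<bar>A s - B b s\<bar> \<le> pi/2"
    proof (rule arg_near_chord_from_start(1)[of b s "B b" \<gamma> A p t s])
      show "continuous_on {b..s} (B b)" using s by (intro cB1) (auto intro!: continuous_intros)
      show "continuous_on {b..s} A" by (rule continuous_on_subset[OF A(1)]) (use s in auto)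
    qed (use s L B inj A(2,3) npb dp t in auto)
    then show ?thesis using c[of b s] s L by simp
  qed
  have "\<bar>A (b + L) - (B (b + L) (b + L) - c)\<bar> \<le> pi/2"
  proof (rule continuous_le_on_closure[of "{b + L/2..<b + L}" "\<lambda>s. \<bar>A s - (B s (b + L) - c)\<bar>"])
    have "continuous_on {b + L/2..b + L} (\<lambda>s. \<bar>A s - (B s (b + L) - c)\<bar>)"
      using L by (intro continuous_on_rabs continuous_on_diff continuous_on_const cB1 continuous_on_subset[OF A(1)])
         (auto intro!: continuous_intros)
    then show "continuous_on (closure {b + L/2..<b + L}) (\<lambda>s. \<bar>A s - (B s (b + L) - c)\<bar>)" using L by simp
  qed (use near L in auto)
  then have "\<bar>3 * pi/2 - c\<bar> \<le> pi/2" using turn A(2) c2[of b] by (simp add: abs_le_iff)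
  then have bounds: "pi \<le> c" "c \<le> pi * 2" unfolding abs_le_iff by (simp_all add: field_simps)
  from rev[of 0 "L/2"] L obtain k :: int where k: "c = - pi + 2 * pi * k" unfolding c_def by auto
  have ck: "c = pi * of_int (2 * k - 1)" unfolding k by (simp add: algebra_simps)
  have "pi * 1 \<le> pi * of_int (2 * k - 1)" "pi * of_int (2 * k - 1) \<le> pi * 2"
    using bounds unfolding ck by simp_all
  then have "1 \<le> real_of_int (2 * k - 1)" "real_of_int (2 * k - 1) \<le> 2"
    by (simp_all only: mult_le_cancel_left_pos[OF pi_gt_zero])
  then have "k = 1" by linarith
  then show ?thesis using c2[of s] k by simp
qed

section \<open>The length function of the inner parallel curve\<close>

lemma ccw_arclength_param_tangent:
  assumes "ccw_arclength_param \<Omega> L \<gamma>"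
  obtains \<gamma>' where "\<And>s. (\<gamma> has_vector_derivative \<gamma>' s) (at s)" "continuous_on UNIV \<gamma>'"
    "\<And>s. cmod (\<gamma>' s) = 1" "\<And>s. \<gamma>' (s + L) = \<gamma>' s" "\<And>s. inward_normal \<gamma> s = \<i> * \<gamma>' s"
proof -
  have per: "\<gamma> (s + L) = \<gamma> s" for s
    using assms unfolding ccw_arclength_param_def by blast
  obtain D where D: "D 0 = \<gamma>" "\<And>k s. (D k has_vector_derivative D (Suc k) s) (at s)"
    using assms unfolding ccw_arclength_param_def smooth_on_def by auto
  have deriv: "(\<gamma> has_vector_derivative D 1 s) (at s)" for s using D(2)[of 0 s] D(1) by simp
  then have vd: "vector_derivative \<gamma> (at s) = D 1 s" for s by (rule vector_derivative_at)
  show thesis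
  proof (rule that[OF deriv])
    show "continuous_on UNIV (D 1)"
      using D(2)[of 1] by (metis continuous_at_imp_continuous_on has_vector_derivative_continuous)
    show "cmod (D 1 s) = 1" for s using assms vd unfolding ccw_arclength_param_def by simp
    show "inward_normal \<gamma> s = \<i> * D 1 s" for s unfolding inward_normal_def vd ..
    show "D 1 (s + L) = D 1 s" for s
    proof -
      have "((\<lambda>u. u + L) has_vector_derivative 1) (at s)" by (auto intro!: derivative_eq_intros)
      from vector_diff_chain_at[OF this deriv] have "(\<gamma> has_vector_derivative D 1 (s + L)) (at s)"
        by (simp add: o_def per)
      then show ?thesis using deriv by (metis vector_derivative_at)
    qed
  qed
qed

text \<open>The function is \<open>g s = s - t \<theta>(s)\<close> with the tangent angle \<open>\<theta>(s) = B s s\<close>. For \<open>t = 0\<close> there is no disc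
to fix the orientation, but then \<open>g s = s\<close> and the bound is the Lipschitz property of \<open>\<gamma>\<close>.\<close>

lemma offset_length_function:
  assumes ccw: "ccw_arclength_param \<Omega> L \<gamma>" and L: "L > 0" and t: "t \<ge> 0"
    and b: "0 \<le> b" "b \<le> L" "\<gamma> b + t *\<^sub>R inward_normal \<gamma> b \<in> inner_parallel_curve \<Omega> t"
  obtains g where "continuous_on UNIV g" "\<And>s. g (s + L) = g s + (L - 2 * pi * t)"
    "\<And>s s'. s \<le> s' \<Longrightarrow> s' < s + L \<Longrightarrow> \<gamma> s + t *\<^sub>R inward_normal \<gamma> s \<in> inner_parallel_curve \<Omega> t \<Longrightarrow>
       \<gamma> s' + t *\<^sub>R inward_normal \<gamma> s' \<in> inner_parallel_curve \<Omega> t \<Longrightarrow>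
       cmod ((\<gamma> s' + t *\<^sub>R inward_normal \<gamma> s') - (\<gamma> s + t *\<^sub>R inward_normal \<gamma> s)) \<le> g s' - g s"
proof -
  obtain \<gamma>' where deriv: "\<And>s. (\<gamma> has_vector_derivative \<gamma>' s) (at s)" and cont: "continuous_on UNIV \<gamma>'"
    and speed: "\<And>s. cmod (\<gamma>' s) = 1" and normal: "\<And>s. inward_normal \<gamma> s = \<i> * \<gamma>' s"
    by (rule ccw_arclength_param_tangent[OF ccw]) (rule that)
  have per: "\<gamma> (s + L) = \<gamma> s" and inj0: "inj_on \<gamma> {0..<L}" and fr: "\<gamma> ` {0..<L} = frontier \<Omega>" for s
    using ccw unfolding ccw_arclength_param_def by auto
  have wind: "winding_number (\<lambda>u. \<gamma> (L * u)) z = 1" if "z \<in> \<Omega>" for z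
    using ccw that unfolding ccw_arclength_param_def by auto
  have inj: "\<gamma> y \<noteq> \<gamma> x" if "x < y" "y < x + L" for x y
    using periodic_inj[of \<gamma>, OF per L inj0] that by blast
  have \<sigma>: "\<gamma> s + t *\<^sub>R inward_normal \<gamma> s = \<gamma> s + of_real t * (\<i> * \<gamma>' s)" for s
    unfolding normal by (simp add: scaleR_conv_of_real)
  have inner: "t \<le> cmod (\<gamma> x - q)" if "q \<in> inner_parallel_curve \<Omega> t" for q x
  proof -
    obtain k :: int where k: "x + of_int k * L \<in> {0..<L}" "\<gamma> (x + of_int k * L) = \<gamma> x"
      by (rule periodic_reduce[of \<gamma>, OF per L])
    then have "\<gamma> x \<in> frontier \<Omega>" using fr by (metis image_eqI)
    then have "infdist q (frontier \<Omega>) \<le> dist q (\<gamma> x)" by (rule infdist_le)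
    then show ?thesis using that unfolding inner_parallel_curve_def by (simp add: dist_norm norm_minus_commute)
  qed
  show thesis
  proof (cases "t = 0")
    case True
    have "cmod (\<gamma> s' - \<gamma> s) \<le> s' - s" if "s \<le> s'" for s s'
    proof -
      have "cmod (\<gamma> s' - \<gamma> s) \<le> 1 * norm (s' - s)"
      proof (rule differentiable_bound[of UNIV])
        show "(\<gamma> has_derivative (\<lambda>h. h *\<^sub>R \<gamma>' u)) (at u within UNIV)" for u
          using deriv[of u] by (simp add: has_vector_derivative_def)
        show "onorm (\<lambda>h. h *\<^sub>R \<gamma>' u) \<le> 1" for u
          using speed[of u] by (intro onorm_le) (auto intro: mult_left_le)
      qed auto
      then show ?thesis using that by simp
    qed
    then show thesis using True by (intro that[of "\<lambda>s. s"]) auto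
  next
    case False
    then have t: "t > 0" using t by simp
    obtain B where cB: "continuous_on {(x, y). x \<le> y \<and> y < x + L} (\<lambda>(x, y). B x y)"
      and B: "\<And>x y. x < y \<Longrightarrow> y < x + L \<Longrightarrow> has_arg (\<gamma> y - \<gamma> x) (B x y)"
      and Bd: "\<And>s. \<gamma>' s = cis (B s s)"
      by (rule chord_arg_lift[OF deriv cont speed L inj]) (assumption+, rule that)
    have \<sigma>B: "\<gamma> s + t *\<^sub>R inward_normal \<gamma> s = \<gamma> s + of_real t * (\<i> * cis (B s s))" for s
      unfolding \<sigma> Bd ..
    define p where "p = \<gamma> b + of_real t * (\<i> * cis (B b b))"
    have pS: "p \<in> inner_parallel_curve \<Omega> t" using b(3) unfolding \<sigma>B p_def .
    have "p \<in> \<Omega>"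
    proof -
      have "p \<in> closure \<Omega>" "infdist p (frontier \<Omega>) = t" using pS unfolding inner_parallel_curve_def by auto
      then have "p \<notin> frontier \<Omega>" using t by auto
      then show ?thesis using \<open>p \<in> closure \<Omega>\<close> interior_subset unfolding frontier_def by auto
    qed
    have turn: "B (s + L) (s + L) = B s s + 2 * pi" for s
      by (rule tangent_turns_once[OF deriv cont L per inj cB B b(1,2) t p_def inner[OF pS] wind[OF \<open>p \<in> \<Omega>\<close>]])
    define g where "g s = s - t * B s s" for s
    have "continuous_on UNIV (\<lambda>s. (\<lambda>(x, y). B x y) (s, s))"
      by (rule continuous_on_compose2[OF cB]) (use L in \<open>auto intro!: continuous_intros\<close>)
    then have cg: "continuous_on UNIV g" unfolding g_def by (auto intro!: continuous_intros)
    show thesis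
    proof (rule that[OF cg])
      show "g (s + L) = g s + (L - 2 * pi * t)" for s
        unfolding g_def turn by (simp add: algebra_simps)
      fix s s' assume ss: "s \<le> s'" "s' < s + L"
        and S: "\<gamma> s + t *\<^sub>R inward_normal \<gamma> s \<in> inner_parallel_curve \<Omega> t"
          "\<gamma> s' + t *\<^sub>R inward_normal \<gamma> s' \<in> inner_parallel_curve \<Omega> t"
      show "cmod ((\<gamma> s' + t *\<^sub>R inward_normal \<gamma> s') - (\<gamma> s + t *\<^sub>R inward_normal \<gamma> s)) \<le> g s' - g s"
      proof (cases "s = s'")
        case False
        then have lt: "s < s'" using ss by simp
        have "cmod ((\<gamma> s' + t *\<^sub>R inward_normal \<gamma> s') - (\<gamma> s + t *\<^sub>R inward_normal \<gamma> s))
            \<le> (s' - s) - t * (B s' s' - B s s)"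
        proof (rule chord_turning_bound[where B = B and \<gamma> = \<gamma> and \<gamma>' = \<gamma>', OF lt t _ _ _ _ _ _ \<sigma>B \<sigma>B])
          show "(\<gamma> has_vector_derivative \<gamma>' u) (at u within {s..s'})" for u
            by (rule has_vector_derivative_at_within[OF deriv])
          show "continuous_on {s..s'} \<gamma>'" using cont continuous_on_subset by blast
          show "continuous_on {(x, y). s \<le> x \<and> x \<le> y \<and> y \<le> s'} (\<lambda>(x, y). B x y)"
            by (rule continuous_on_subset[OF cB]) (use ss in auto)
        qed (use ss S inner B inj speed in auto)
        then show ?thesis unfolding g_def by (simp add: algebra_simps)
      qed simp
    qed
  qed
qed

section \<open>Hausdorff length of the arcs\<close>

definition has_small_cover :: "real \<Rightarrow> complex set \<Rightarrow> real \<Rightarrow> bool" where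
  "has_small_cover \<delta> A c \<longleftrightarrow>
     (\<exists>Us. A \<subseteq> \<Union> (set Us) \<and> (\<forall>U\<in>set Us. bounded U \<and> diameter U \<le> \<delta>) \<and> sum_list (map diameter Us) \<le> c)"

lemma has_small_cover_Un:
  assumes "has_small_cover \<delta> A c" "has_small_cover \<delta> B d"
  shows "has_small_cover \<delta> (A \<union> B) (c + d)"
proof -
  obtain Us Vs where "A \<subseteq> \<Union> (set Us)" "\<forall>U\<in>set Us. bounded U \<and> diameter U \<le> \<delta>" "sum_list (map diameter Us) \<le> c"
    "B \<subseteq> \<Union> (set Vs)" "\<forall>U\<in>set Vs. bounded U \<and> diameter U \<le> \<delta>" "sum_list (map diameter Vs) \<le> d"
    using assms unfolding has_small_cover_def by blast
  then show ?thesis unfolding has_small_cover_def by (intro exI[of _ "Us @ Vs"]) auto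
qed

lemma has_small_cover_UN:
  assumes "finite I" "\<And>i. i \<in> I \<Longrightarrow> has_small_cover \<delta> (A i) (c i)"
  shows "has_small_cover \<delta> (\<Union>i\<in>I. A i) (\<Sum>i\<in>I. c i)"
  using assms
proof (induction I rule: finite_induct)
  case empty
  show ?case unfolding has_small_cover_def by (intro exI[of _ "[]"]) auto
next
  case (insert i I)
  then show ?case using has_small_cover_Un[of \<delta> "A i" "c i" "\<Union>i\<in>I. A i" "\<Sum>i\<in>I. c i"] by simp
qed

lemma set_length_le:
  assumes "\<And>\<delta>. \<delta> > 0 \<Longrightarrow> has_small_cover \<delta> A c"
  shows "enn2ereal (set_length A) \<le> ereal c"
proof -
  have c: "c \<ge> 0"
  proof -
    obtain Us where Us: "A \<subseteq> \<Union> (set Us)" "\<forall>U\<in>set Us. bounded U \<and> diameter U \<le> 1" "sum_list (map diameter Us) \<le> c"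
      using assms[OF zero_less_one] unfolding has_small_cover_def by blast
    have "0 \<le> sum_list (map diameter Us)" using Us by (intro sum_list_nonneg) (auto intro: diameter_ge_0)
    then show ?thesis using Us by simp
  qed
  have "set_length A \<le> ennreal c"
    unfolding set_length_def
  proof (rule SUP_least)
    fix \<delta> :: real assume "\<delta> \<in> {0<..}"
    then have \<delta>: "\<delta> > 0" by simp
    obtain Us where Us: "A \<subseteq> \<Union> (set Us)" "\<forall>U\<in>set Us. bounded U \<and> diameter U \<le> \<delta>" "sum_list (map diameter Us) \<le> c"
      using assms[OF \<delta>] unfolding has_small_cover_def by auto
    define U where "U i = (if i < length Us then Us ! i else {})" for i
    have "(\<Sum>i. ennreal (diameter (U i))) = (\<Sum>i<length Us. ennreal (diameter (U i)))"
      by (rule suminf_finite) (auto simp: U_def)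
    also have "\<dots> = ennreal (\<Sum>i<length Us. diameter (U i))"
      by (rule sum_ennreal) (use Us(2) in \<open>auto simp: U_def intro!: diameter_ge_0\<close>)
    also have "(\<Sum>i<length Us. diameter (U i)) = sum_list (map diameter Us)"
      by (simp add: U_def sum_list_sum_nth atLeast0LessThan)
    also have "ennreal \<dots> \<le> ennreal c" using Us(3) by (rule ennreal_leI)
    finally have le: "(\<Sum>i. ennreal (diameter (U i))) \<le> ennreal c" .
    have mem: "U \<in> {U. A \<subseteq> (\<Union>i. U i) \<and> (\<forall>i. bounded (U i) \<and> diameter (U i) \<le> \<delta>)}"
    proof (intro CollectI conjI allI)
      show "A \<subseteq> (\<Union>i. U i)"
      proof
        fix x assume "x \<in> A"
        then obtain V where "V \<in> set Us" "x \<in> V" using Us(1) by auto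
        then obtain i where "i < length Us" "x \<in> Us ! i" by (metis in_set_conv_nth)
        then show "x \<in> (\<Union>i. U i)" unfolding U_def by auto
      qed
      show "bounded (U i)" "diameter (U i) \<le> \<delta>" for i using Us(2) \<delta> unfolding U_def by auto
    qed
    show "(INF U\<in>{U. A \<subseteq> (\<Union>i. U i) \<and> (\<forall>i. bounded (U i) \<and> diameter (U i) \<le> \<delta>)}. \<Sum>i. ennreal (diameter (U i))) \<le> ennreal c"
      by (rule INF_lower2[where f = "\<lambda>U. \<Sum>i. ennreal (diameter (U i))", OF mem le])
  qed
  then have "enn2ereal (set_length A) \<le> enn2ereal (ennreal c)" by (simp add: less_eq_ennreal.rep_eq)
  then show ?thesis using c by simp
qed

text \<open>The bound is only assumed for parameters closer than \<open>\<eta>\<close>, below with \<open>\<eta> = L\<close>: an arc of full parameter length \<open>L\<close> is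
possible, and the estimate for \<open>\<sigma>\<close> is available for parameter differences below \<open>L\<close> only. Short
pieces have diameter at most the increase of \<open>g\<close>, and these increases add up.\<close>

lemma arc_has_small_cover:
  fixes \<sigma> :: "real \<Rightarrow> complex"
  assumes ab: "a \<le> b" and \<delta>: "\<delta> > 0" and \<eta>: "\<eta> > 0" and cg: "continuous_on UNIV g"
    and bound: "\<And>x y. a \<le> x \<Longrightarrow> x \<le> y \<Longrightarrow> y \<le> b \<Longrightarrow> y < x + \<eta> \<Longrightarrow> cmod (\<sigma> y - \<sigma> x) \<le> g y - g x"
  shows "has_small_cover \<delta> (\<sigma> ` {a..b}) (g b - g a)"
proof -
  have "u \<le> v \<longrightarrow> a \<le> u \<longrightarrow> v \<le> b \<longrightarrow> has_small_cover \<delta> (\<sigma> ` {u..v}) (g v - g u)" if "u \<le> v" for u v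
    using that
  proof (induction rule: Bolzano)
    case (trans u v w)
    then show ?case
      using has_small_cover_Un[of \<delta> "\<sigma> ` {u..v}" "g v - g u" "\<sigma> ` {v..w}" "g w - g v"]
      by (auto simp: image_Un[symmetric] ivl_disj_un_two_touch)
  next
    case (local x)
    obtain d where d: "d > 0" "\<And>y. \<bar>y - x\<bar> < d \<Longrightarrow> \<bar>g y - g x\<bar> < \<delta>/2"
      using cg \<delta> unfolding continuous_on_iff dist_real_def by (metis UNIV_I half_gt_zero)
    show ?case
    proof (intro exI[of _ "min d \<eta>"] conjI allI impI)
      fix u v assume uv: "u \<le> x \<and> x \<le> v \<and> v - u < min d \<eta>" "u \<le> v" "a \<le> u" "v \<le> b"
      have mono: "g y \<le> g z" if "u \<le> y" "y \<le> z" "z \<le> v" for y z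
      proof -
        have "cmod (\<sigma> z - \<sigma> y) \<le> g z - g y" using that uv by (intro bound) auto
        then show ?thesis using norm_ge_zero[of "\<sigma> z - \<sigma> y"] by linarith
      qed
      have near: "cmod (\<sigma> y - \<sigma> z) \<le> g v - g u" if "y \<in> {u..v}" "z \<in> {u..v}" for y z
      proof (cases "y \<le> z")
        case True
        have "cmod (\<sigma> z - \<sigma> y) \<le> g z - g y" using that uv True by (intro bound) auto
        then show ?thesis using mono[of u y] mono[of z v] that True by (simp add: norm_minus_commute)
      next
        case False
        have "cmod (\<sigma> y - \<sigma> z) \<le> g y - g z" using that uv False by (intro bound) auto
        then show ?thesis using mono[of u z] mono[of y v] that False by simp
      qed
      have di: "diameter (\<sigma> ` {u..v}) \<le> g v - g u"
        using near mono[of u v] uv by (intro diameter_le) auto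
      have "\<bar>g u - g x\<bar> < \<delta>/2" "\<bar>g v - g x\<bar> < \<delta>/2" using uv by (intro d; auto)+
      then have "g v - g u \<le> \<delta>" by linarith
      moreover have "bounded (\<sigma> ` {u..v})"
        unfolding bounded_def using near[of u] uv by (intro exI[of _ "\<sigma> u"] exI[of _ "g v - g u"]) (auto simp: dist_norm)
      ultimately show "has_small_cover \<delta> (\<sigma> ` {u..v}) (g v - g u)"
        unfolding has_small_cover_def using di by (intro exI[of _ "[\<sigma> ` {u..v}]"]) auto
    qed (use d \<eta> in auto)
  qed
  then show ?thesis using ab by blast
qed

section \<open>Jumps between the components\<close>

lemma connected_subset_of_disjoint_closed:
  assumes "connected C" "C \<subseteq> (\<Union>n\<in>I. \<Gamma> n)" "finite I" "\<And>n. n \<in> I \<Longrightarrow> closed (\<Gamma> n)"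
    and "disjoint_family_on \<Gamma> I" and "n \<in> I" "C \<inter> \<Gamma> n \<noteq> {}"
  shows "C \<subseteq> \<Gamma> n"
proof -
  let ?R = "\<Union>k\<in>I - {n}. \<Gamma> k"
  have "closed ?R" using assms(3,4) by (intro closed_UN) auto
  moreover have "\<Gamma> n \<inter> ?R \<inter> C = {}"
    using assms(5,6) unfolding disjoint_family_on_def by fastforce
  moreover have cover: "C \<subseteq> \<Gamma> n \<union> ?R" using assms(2) by blast
  ultimately have "\<Gamma> n \<inter> C = {} \<or> ?R \<inter> C = {}"
    using connected_closedD[OF assms(1) _ _ assms(4)[OF assms(6)], of ?R] by simp
  then have "?R \<inter> C = {}" using assms(7) by (simp add: Int_commute)
  then show ?thesis using cover by blast
qed

lemma cyclic_sequence_leaves: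
  fixes c :: "nat \<Rightarrow> 'a"
  assumes "k0 \<in> {1..m}" "c k0 = n" "j \<in> {1..m}" "c j \<noteq> n"
  obtains k where "k \<in> {1..m}" "c k = n" "c (if k = m then 1 else Suc k) \<noteq> n"
proof (rule ccontr)
  assume "\<not> thesis"
  then have stay: "c (if k = m then 1 else Suc k) = n" if "k \<in> {1..m}" "c k = n" for k
    using that \<open>\<And>k. \<lbrakk>k \<in> {1..m}; c k = n; c (if k = m then 1 else Suc k) \<noteq> n\<rbrakk> \<Longrightarrow> thesis\<close> by blast
  have up: "k \<le> m \<Longrightarrow> c k = n" if "i \<le> k" "i \<in> {1..m}" "c i = n" for i k
    using that(1)
  proof (induction k rule: dec_induct)
    case (step k)
    then show ?case using stay[of k] that(2) by (auto split: if_splits)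
  qed (use that in simp)
  have "c m = n" using up[of k0 m] assms by auto
  then have "c 1 = n" using stay[of m] assms by auto
  then show False using up[of 1 j] assms by auto
qed

text \<open>Each arc \<open>C k\<close> lies in one of the disjoint closed sets. If \<open>\<Gamma> n\<close> is not everything, then some arc in
\<open>\<Gamma> n\<close> is followed cyclically by an arc in another set. The index of the arc determines \<open>n\<close>, so no
jump is used twice.\<close>

lemma sum_setdist_le_sum_jumps:
  fixes \<Gamma> :: "nat \<Rightarrow> complex set" and C :: "nat \<Rightarrow> complex set"
  assumes S: "S = (\<Union>n\<in>{1..N}. \<Gamma> n)" "S = (\<Union>k\<in>{1..m}. C k)"
    and \<Gamma>: "\<And>n. n \<in> {1..N} \<Longrightarrow> closed (\<Gamma> n) \<and> \<Gamma> n \<noteq> {}" "disjoint_family_on \<Gamma> {1..N}"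
    and C: "\<And>k. k \<in> {1..m} \<Longrightarrow> connected (C k) \<and> x k \<in> C k \<and> y k \<in> C k"
  shows "(\<Sum>n=1..N. setdist (\<Gamma> n) (S - \<Gamma> n)) \<le> (\<Sum>k=1..m. dist (y k) (x (if k = m then 1 else Suc k)))"
proof -
  let ?next = "\<lambda>k. if k = m then 1 else Suc k"
  have "\<exists>n\<in>{1..N}. C k \<subseteq> \<Gamma> n" if k: "k \<in> {1..m}" for k
  proof -
    obtain n where n: "n \<in> {1..N}" "x k \<in> \<Gamma> n" using C[OF k] S k by blast
    have "C k \<inter> \<Gamma> n \<noteq> {}" using C[OF k] n by blast
    have "C k \<subseteq> \<Gamma> n"
      by (rule connected_subset_of_disjoint_closed[of "C k" \<Gamma> "{1..N}" n]) (use C[OF k] k S \<Gamma> n \<open>C k \<inter> \<Gamma> n \<noteq> {}\<close> in auto)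
    then show ?thesis using n by blast
  qed
  then obtain c where c: "\<And>k. k \<in> {1..m} \<Longrightarrow> c k \<in> {1..N} \<and> C k \<subseteq> \<Gamma> (c k)" by metis
  have disj: "n = n'" if "z \<in> \<Gamma> n" "z \<in> \<Gamma> n'" "n \<in> {1..N}" "n' \<in> {1..N}" for z n n'
    using \<Gamma>(2) that unfolding disjoint_family_on_def by blast
  define X where "X = {n\<in>{1..N}. S - \<Gamma> n \<noteq> {}}"
  have "\<exists>k\<in>{1..m}. c k = n \<and> c (?next k) \<noteq> n" if n: "n \<in> X" for n
  proof -
    obtain z where z: "z \<in> S" "z \<notin> \<Gamma> n" using n unfolding X_def by blast
    then obtain j where j: "j \<in> {1..m}" "z \<in> C j" using S(2) by blast
    then have "c j \<noteq> n" using c z by blast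
    obtain w where w: "w \<in> \<Gamma> n" using \<Gamma> n unfolding X_def by blast
    then have "w \<in> S" using S(1) n unfolding X_def by blast
    then obtain k where k: "k \<in> {1..m}" "w \<in> C k" using S(2) by blast
    then have "c k = n" using c w disj n unfolding X_def by blast
    then show ?thesis using cyclic_sequence_leaves[of k m c n j] k j \<open>c j \<noteq> n\<close> by blast
  qed
  then obtain f where f: "\<And>n. n \<in> X \<Longrightarrow> f n \<in> {1..m} \<and> c (f n) = n \<and> c (?next (f n)) \<noteq> n" by metis
  have inj: "inj_on f X" by (rule inj_onI) (metis f)
  have "(\<Sum>n=1..N. setdist (\<Gamma> n) (S - \<Gamma> n)) = (\<Sum>n\<in>X. setdist (\<Gamma> n) (S - \<Gamma> n))"
  proof (rule sum.mono_neutral_right)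
    show "\<forall>n\<in>{1..N} - X. setdist (\<Gamma> n) (S - \<Gamma> n) = 0"
    proof
      fix n assume "n \<in> {1..N} - X"
      then have "S - \<Gamma> n = {}" unfolding X_def by blast
      then show "setdist (\<Gamma> n) (S - \<Gamma> n) = 0" by (simp only: setdist_empty2)
    qed
  qed (auto simp: X_def)
  also have "\<dots> \<le> (\<Sum>n\<in>X. dist (y (f n)) (x (?next (f n))))"
  proof (rule sum_mono)
    fix n assume n: "n \<in> X"
    define k where "k = f n"
    define k' where "k' = ?next k"
    have k: "k \<in> {1..m}" "c k = n" and ck': "c k' \<noteq> n" using f[OF n] unfolding k_def k'_def by auto
    then have k': "k' \<in> {1..m}" unfolding k'_def by auto
    have "y k \<in> C k" "C k \<subseteq> \<Gamma> n" using C[OF k(1)] c[OF k(1)] k(2) by auto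
    then have y: "y k \<in> \<Gamma> n" by (rule subsetD[rotated])
    have x: "x k' \<in> \<Gamma> (c k')" "c k' \<in> {1..N}" using C[OF k'] c[OF k'] by blast+
    then have "x k' \<notin> \<Gamma> n" using disj[of "x k'" n "c k'"] ck' n unfolding X_def by blast
    then have "x k' \<in> S - \<Gamma> n" using S(1) x by blast
    with y have "setdist (\<Gamma> n) (S - \<Gamma> n) \<le> dist (y k) (x k')" by (rule setdist_le_dist)
    then show "setdist (\<Gamma> n) (S - \<Gamma> n) \<le> dist (y (f n)) (x (?next (f n)))" unfolding k'_def k_def .
  qed
  also have "\<dots> = (\<Sum>k\<in>f ` X. dist (y k) (x (?next k)))" by (simp add: sum.reindex[OF inj])
  also have "\<dots> \<le> (\<Sum>k=1..m. dist (y k) (x (?next k)))"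
    by (rule sum_mono2) (use f in auto)
  finally show ?thesis .
qed

section \<open>The length bound\<close>

(* setdist A {} = 0, which is the convention for N = 1. *)
theorem corollary7p1:
  fixes \<Omega> :: "complex set" and L :: real and \<gamma> :: "real \<Rightarrow> complex"
    and T :: "real set" and t :: real and N :: nat and \<Gamma> :: "nat \<Rightarrow> complex set"
  assumes "smooth_domain \<Omega>" and "bounded \<Omega>" and "simply_connected \<Omega>"
    and "L > 0" and "ccw_arclength_param \<Omega> L \<gamma>"
    and "hartman_set \<Omega> L \<gamma> T" and "t \<in> T"
    and "closed_curve_decomposition (inner_parallel_curve \<Omega> t) N \<Gamma>"
  shows "enn2ereal (set_length (inner_parallel_curve \<Omega> t))
           + ereal (\<Sum>n=1..N. setdist (\<Gamma> n) (inner_parallel_curve \<Omega> t - \<Gamma> n))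
         \<le> ereal (L - 2 * pi * t)"
proof -
  define S where "S = inner_parallel_curve \<Omega> t"
  define \<sigma> where "\<sigma> s = \<gamma> s + t *\<^sub>R inward_normal \<gamma> s" for s
  have L: "L > 0" by fact
  have t: "t \<ge> 0" using assms(6,7) unfolding hartman_set_def by auto
  have "regular_distance \<Omega> L \<gamma> t" using assms(6,7) unfolding hartman_set_def by auto
  then obtain m a b where m: "m \<ge> (1::nat)" and ends: "0 \<le> a 1" "b m \<le> L"
    and ab: "\<And>k. k \<in> {1..m} \<Longrightarrow> a k < b k" and ba: "\<And>k. k \<in> {1..<m} \<Longrightarrow> b k < a (Suc k)"
    and Sarcs0: "inner_parallel_curve \<Omega> t = (\<Union>k\<in>{1..m}. (\<lambda>s. \<gamma> s + t *\<^sub>R inward_normal \<gamma> s) ` {a k..b k})"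
    unfolding regular_distance_def by (elim conjE exE) (rule that, (assumption | drule (1) bspec)+)
  have Sarcs: "S = (\<Union>k\<in>{1..m}. \<sigma> ` {a k..b k})" using Sarcs0 unfolding S_def \<sigma>_def .
  have aS: "\<sigma> s \<in> S" if "k \<in> {1..m}" "s \<in> {a k..b k}" for s k using that Sarcs by blast
  have a_ge: "0 \<le> a k" if "1 \<le> k" "k \<le> m" for k
    using that
  proof (induction k rule: dec_induct)
    case (step k)
    then show ?case using ab[of k] ba[of k] by force
  qed (use ends in simp)
  have b_le: "b k \<le> L" if "k \<le> m" "1 \<le> k" for k
    using that
  proof (induction k rule: inc_induct)
    case (step k)
    then show ?case using ab[of "Suc k"] ba[of k] by force
  qed (use ends in simp)
  obtain \<gamma>' where deriv: "\<And>s. (\<gamma> has_vector_derivative \<gamma>' s) (at s)" and cont: "continuous_on UNIV \<gamma>'"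
    and per': "\<And>s. \<gamma>' (s + L) = \<gamma>' s" and normal: "\<And>s. inward_normal \<gamma> s = \<i> * \<gamma>' s"
    by (rule ccw_arclength_param_tangent[OF assms(5)]) (rule that)
  have per: "\<sigma> (s + L) = \<sigma> s" for s
    using assms(5) unfolding ccw_arclength_param_def \<sigma>_def normal per' by simp
  have c\<sigma>: "continuous_on U \<sigma>" for U
  proof -
    have "continuous_on U \<gamma>"
      using deriv by (meson continuous_at_imp_continuous_on has_vector_derivative_continuous)
    moreover have "continuous_on U \<gamma>'" using cont continuous_on_subset by blast
    moreover have "\<sigma> = (\<lambda>s. \<gamma> s + t *\<^sub>R (\<i> * \<gamma>' s))" unfolding \<sigma>_def normal ..
    ultimately show ?thesis by (auto intro!: continuous_intros)
  qed
  have b1: "a 1 \<le> L" using ab[of 1] b_le[of 1] m by force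
  have "\<sigma> (a 1) \<in> S" using aS[of 1 "a 1"] ab[of 1] m by force
  then obtain g where cg: "continuous_on UNIV g" and gL: "\<And>s. g (s + L) = g s + (L - 2 * pi * t)"
    and g: "\<And>s s'. s \<le> s' \<Longrightarrow> s' < s + L \<Longrightarrow> \<sigma> s \<in> S \<Longrightarrow> \<sigma> s' \<in> S \<Longrightarrow> cmod (\<sigma> s' - \<sigma> s) \<le> g s' - g s"
    using offset_length_function[OF assms(5) L t ends(1) b1] unfolding \<sigma>_def S_def by metis
  have len: "enn2ereal (set_length S) \<le> ereal (\<Sum>k=1..m. g (b k) - g (a k))"
  proof (rule set_length_le)
    fix \<delta> :: real assume \<delta>: "\<delta> > 0"
    show "has_small_cover \<delta> S (\<Sum>k=1..m. g (b k) - g (a k))" unfolding Sarcs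
    proof (rule has_small_cover_UN)
      fix k assume k: "k \<in> {1..m}"
      show "has_small_cover \<delta> (\<sigma> ` {a k..b k}) (g (b k) - g (a k))"
        using ab[OF k] by (intro arc_has_small_cover[OF _ \<delta> L cg] g aS[OF k]) auto
    qed simp
  qed
  have dists: "(\<Sum>n=1..N. setdist (\<Gamma> n) (S - \<Gamma> n)) \<le>
      (\<Sum>k=1..m. dist (\<sigma> (b k)) (\<sigma> (a (if k = m then 1 else Suc k))))"
  proof (rule sum_setdist_le_sum_jumps[OF _ Sarcs])
    have dec: "closed_curve_decomposition S N \<Gamma>" using assms(8) unfolding S_def .
    then show "S = (\<Union>n\<in>{1..N}. \<Gamma> n)" "disjoint_family_on \<Gamma> {1..N}"
      unfolding closed_curve_decomposition_def by auto
    show "closed (\<Gamma> n) \<and> \<Gamma> n \<noteq> {}" if "n \<in> {1..N}" for n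
      using dec that unfolding closed_curve_decomposition_def simple_closed_pw_smooth_curve_def
      by (metis closed_simple_path_image path_image_nonempty)
    show "connected (\<sigma> ` {a k..b k}) \<and> \<sigma> (a k) \<in> \<sigma> ` {a k..b k} \<and> \<sigma> (b k) \<in> \<sigma> ` {a k..b k}"
      if "k \<in> {1..m}" for k
      using ab[OF that] c\<sigma> by (auto intro!: connected_continuous_image)
  qed
  have total: "(\<Sum>k=1..m. g (b k) - g (a k)) + (\<Sum>k=1..m. dist (\<sigma> (b k)) (\<sigma> (a (if k = m then 1 else Suc k)))) \<le> L - 2 * pi * t"
  proof -
    \<comment> \<open>Starting points of the arcs, continued by the first one of the next period: the last gap is \<open>[b m, a 1 + L]\<close>.\<close>
    define a' where "a' k = (if k \<le> m then a k else a 1 + L)" for k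
    have jump: "dist (\<sigma> (b k)) (\<sigma> (a (if k = m then 1 else Suc k))) \<le> g (a' (Suc k)) - g (b k)"
      if k: "k \<in> {1..m}" for k
    proof -
      have s: "\<sigma> (a' (Suc k)) = \<sigma> (a (if k = m then 1 else Suc k))"
        using k per unfolding a'_def by auto
      have "b k \<le> a' (Suc k)" "a' (Suc k) < b k + L"
      proof -
        show "b k \<le> a' (Suc k)"
          using ba[of k] b_le[of k] k ends unfolding a'_def by (cases "k = m") auto
        show "a' (Suc k) < b k + L"
        proof (cases "k = m")
          case True
          have "a 1 < b m"
          proof (cases "m = 1")
            case False
            have "a 1 \<le> a k" if "1 \<le> k" "k \<le> m" for k using that
            proof (induction k rule: dec_induct)
              case (step k)
              then show ?case using ab[of k] ba[of k] by force
            qed simp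
            then show ?thesis using ab[of m] m by force
          qed (use ab m in auto)
          then show ?thesis using True unfolding a'_def by simp
        next
          case False
          then have "a (Suc k) < L" "0 < b k"
            using k ab[of "Suc k"] b_le[of "Suc k"] ab[of k] a_ge[of k] by auto
          then show ?thesis using False k unfolding a'_def by simp
        qed
      qed
      moreover have "\<sigma> (b k) \<in> S" using aS[OF k] ab[OF k] by auto
      moreover have "\<sigma> (a' (Suc k)) \<in> S"
        unfolding s using aS[of "if k = m then 1 else Suc k"] ab[of "if k = m then 1 else Suc k"] k m by auto
      ultimately show ?thesis using g[of "b k" "a' (Suc k)"] unfolding s by (simp add: dist_norm norm_minus_commute)
    qed
    have "(\<Sum>k=1..m. g (b k) - g (a k)) + (\<Sum>k=1..m. dist (\<sigma> (b k)) (\<sigma> (a (if k = m then 1 else Suc k))))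
        \<le> (\<Sum>k=1..m. g (b k) - g (a k)) + (\<Sum>k=1..m. g (a' (Suc k)) - g (b k))"
      by (intro add_left_mono sum_mono jump)
    also have "\<dots> = (\<Sum>k=1..m. g (a' (Suc k)) - g (a' k))"
      unfolding sum.distrib[symmetric] by (rule sum.cong) (auto simp: a'_def)
    also have "\<dots> = g (a' (Suc m)) - g (a' 1)" using m by (intro sum_Suc_diff) auto
    also have "\<dots> = L - 2 * pi * t" using m gL unfolding a'_def by simp
    finally show ?thesis .
  qed
  have "enn2ereal (set_length S) + ereal (\<Sum>n=1..N. setdist (\<Gamma> n) (S - \<Gamma> n))
      \<le> ereal (\<Sum>k=1..m. g (b k) - g (a k)) + ereal (\<Sum>k=1..m. dist (\<sigma> (b k)) (\<sigma> (a (if k = m then 1 else Suc k))))"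
    by (rule add_mono[OF len]) (simp only: ereal_less_eq dists)
  also have "\<dots> \<le> ereal (L - 2 * pi * t)"
    unfolding plus_ereal.simps ereal_less_eq by (rule total)
  finally show ?thesis unfolding S_def .
qed

end
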